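(* Let $k$ be a field of characteristic zero which contains a non-square $\alpha\in k^*\setminus (k^* )^2$. Then there is a one-dimensional commutative connected reductive $k$-group $G$ with a non-linearizable action on $\mathbb{A}^4$.
   Context: A $k$-group is an algebraic group defined over $k$; $\mathbb{A}^n$ is affine $n$-space over $k$. An action of a $k$-group $G$ on $\mathbb{A}^n$ (defined over $k$) is a group action given by a morphism of $k$-varieties $\mu: G\times\mathbb{A}^n\to\mathbb{A}^n$. Such an action is called linearizable (over $k$) if and only if there exists an automorphism $\phi$ of $\mathbb{A}^n$ as a $k$-variety such that $v\mapsto \phi(\mu(g,\phi^{-1}(v)))$ is a linear map for every $g\in G$ (here points of $G$ and $\mathbb{A}^n$ may be taken over an algebraic closure $\bar k$). "Non-linearizable" means not linearizable over $k$. *)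

theory Defs
  imports
    "Jordan_Normal_Form.Matrix"
    "HOL-Algebra.Algebraic_Closure_Type"
    "HOL-Algebra.Coset"
    "HOL-Algebra.Group_Action"
    "HOL-Analysis.Abstract_Topology"
    "HOL-Library.Extended_Nat"
begin

text \<open>
  Varieties over a field \<open>k\<close> are represented classically, by their points over the algebraic
  closure of \<open>k\<close>: affine \<open>n\<close>-space is \<open>carrier_vec n\<close> over \<open>'k alg_closure\<close>, and a parameter \<open>K\<close>
  is the set of admissible coefficients: \<open>ground_field\<close> for objects defined over \<open>k\<close>, and \<open>UNIV\<close>
  for objects over the algebraic closure. In characteristic zero \<open>k\<close> is perfect, so that a zero
  set of polynomials over \<open>k\<close> is defined over \<open>k\<close>, and its \<open>k\<close>-regular functions are the
  restrictions of the polynomials over \<open>k\<close>.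
\<close>

abbreviation ground_field :: "'k::field alg_closure set" where
  "ground_field \<equiv> range to_ac"

text \<open>
  The functions on affine \<open>n\<close>-space given by polynomials in \<open>n\<close> variables with coefficients in \<open>K\<close>
  (where \<open>K\<close> is a subring). As an algebraically closed field is infinite, such a polynomial is
  determined by its function.
\<close>

inductive_set polyfun :: "'b::field set \<Rightarrow> nat \<Rightarrow> ('b vec \<Rightarrow> 'b) set"
  for K :: "'b set" and n :: nat where
  const: "c \<in> K \<Longrightarrow> (\<lambda>x. c) \<in> polyfun K n"
| coord: "i < n \<Longrightarrow> (\<lambda>x. x $ i) \<in> polyfun K n"
| add: "p \<in> polyfun K n \<Longrightarrow> q \<in> polyfun K n \<Longrightarrow> (\<lambda>x. p x + q x) \<in> polyfun K n"
| mult: "p \<in> polyfun K n \<Longrightarrow> q \<in> polyfun K n \<Longrightarrow> (\<lambda>x. p x * q x) \<in> polyfun K n"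

definition zero_locus :: "nat \<Rightarrow> ('b::field vec \<Rightarrow> 'b) set \<Rightarrow> 'b vec set" where
  "zero_locus n S = {x \<in> carrier_vec n. \<forall>p\<in>S. p x = 0}"

definition zariski :: "'b::field set \<Rightarrow> nat \<Rightarrow> 'b vec topology" where
  "zariski K n = topology (\<lambda>U. \<exists>S \<subseteq> polyfun K n. U = carrier_vec n - zero_locus n S)"

lemma zero_locus_Un:
  "zero_locus n S \<union> zero_locus n T = zero_locus n ((\<lambda>(p, q) x. p x * q x) ` (S \<times> T))"
proof (rule Set.set_eqI)
  fix x
  have "(\<forall>r \<in> (\<lambda>(p, q) x. p x * q x) ` (S \<times> T). r x = 0) \<longleftrightarrow>
      (\<forall>p\<in>S. p x = 0) \<or> (\<forall>q\<in>T. q x = 0)"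
    by simp
  then show "x \<in> zero_locus n S \<union> zero_locus n T \<longleftrightarrow>
      x \<in> zero_locus n ((\<lambda>(p, q) x. p x * q x) ` (S \<times> T))"
    unfolding zero_locus_def by blast
qed

lemma istopology_zariski:
  "istopology (\<lambda>U. \<exists>S \<subseteq> polyfun K n. U = carrier_vec n - zero_locus n S)"
  unfolding istopology_def
proof (intro conjI allI impI)
  fix U V :: "'a vec set"
  assume "\<exists>S \<subseteq> polyfun K n. U = carrier_vec n - zero_locus n S"
    and "\<exists>S \<subseteq> polyfun K n. V = carrier_vec n - zero_locus n S"
  then obtain S T where S: "S \<subseteq> polyfun K n" "U = carrier_vec n - zero_locus n S"
    and T: "T \<subseteq> polyfun K n" "V = carrier_vec n - zero_locus n T"
    by metis
  let ?R = "(\<lambda>(p, q) x. p x * q x) ` (S \<times> T)"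
  have "?R \<subseteq> polyfun K n"
    using S(1) T(1) by (auto intro!: polyfun.mult)
  moreover have "U \<inter> V = carrier_vec n - zero_locus n ?R"
    unfolding S(2) T(2) zero_locus_Un[symmetric] by blast
  ultimately show "\<exists>S \<subseteq> polyfun K n. U \<inter> V = carrier_vec n - zero_locus n S"
    by (intro exI[of _ ?R] conjI)
next
  fix \<K> :: "'a vec set set"
  assume "\<forall>U\<in>\<K>. \<exists>S \<subseteq> polyfun K n. U = carrier_vec n - zero_locus n S"
  from bchoice[OF this] obtain S
    where S: "\<forall>U\<in>\<K>. S U \<subseteq> polyfun K n \<and> U = carrier_vec n - zero_locus n (S U)"
    by (elim exE)
  have mem: "x \<in> U \<longleftrightarrow> x \<in> carrier_vec n \<and> (\<exists>p\<in>S U. p x \<noteq> 0)" if "U \<in> \<K>" for x U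
  proof -
    have eq: "U = carrier_vec n - zero_locus n (S U)"
      using bspec[OF S that] by (rule conjunct2)
    show ?thesis
      by (subst eq) (auto simp: zero_locus_def)
  qed
  have "\<Union>\<K> = carrier_vec n - zero_locus n (\<Union>(S ` \<K>))"
  proof (rule Set.set_eqI)
    fix x
    have "x \<in> \<Union>\<K> \<longleftrightarrow> (\<exists>U\<in>\<K>. x \<in> carrier_vec n \<and> (\<exists>p\<in>S U. p x \<noteq> 0))"
      unfolding Union_iff by (intro bex_cong refl mem)
    also have "\<dots> \<longleftrightarrow> x \<in> carrier_vec n - zero_locus n (\<Union>(S ` \<K>))"
      unfolding zero_locus_def by blast
    finally show "x \<in> \<Union>\<K> \<longleftrightarrow> x \<in> carrier_vec n - zero_locus n (\<Union>(S ` \<K>))" .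
  qed
  moreover have "\<Union>(S ` \<K>) \<subseteq> polyfun K n"
    by (rule UN_least) (rule S[rule_format, THEN conjunct1])
  ultimately show "\<exists>S \<subseteq> polyfun K n. \<Union>\<K> = carrier_vec n - zero_locus n S"
    by (intro exI[of _ "\<Union>(S ` \<K>)"] conjI)
qed

lemma openin_zariski:
  "openin (zariski K n) U \<longleftrightarrow> (\<exists>S \<subseteq> polyfun K n. U = carrier_vec n - zero_locus n S)"
  unfolding zariski_def topology_inverse'[OF istopology_zariski] by (rule refl)

lemma topspace_zariski:
  assumes "1 \<in> K"
  shows "topspace (zariski K n) = carrier_vec n"
proof
  show "topspace (zariski K n) \<subseteq> carrier_vec n"
    using openin_topspace[of "zariski K n"] unfolding openin_zariski by blast
  have "carrier_vec n = carrier_vec n - zero_locus n {\<lambda>x. 1}" "{\<lambda>x. 1} \<subseteq> polyfun K n"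
    using assms by (auto simp: zero_locus_def intro: polyfun.const)
  then have "openin (zariski K n) (carrier_vec n)"
    unfolding openin_zariski by blast
  then show "carrier_vec n \<subseteq> topspace (zariski K n)"
    by (rule openin_subset)
qed

lemma closedin_zariski:
  assumes "1 \<in> K"
  shows "closedin (zariski K n) Z \<longleftrightarrow> (\<exists>S \<subseteq> polyfun K n. Z = zero_locus n S)"
proof -
  have sub: "zero_locus n S \<subseteq> carrier_vec n" for S :: "('a vec \<Rightarrow> 'a) set"
    by (auto simp: zero_locus_def)
  show ?thesis
    unfolding closedin_def topspace_zariski[OF assms] openin_zariski
    by (metis sub double_diff subset_refl)
qed

definition irreducible_in :: "'a topology \<Rightarrow> 'a set \<Rightarrow> bool" where
  "irreducible_in T Z \<longleftrightarrow> Z \<subseteq> topspace T \<and> Z \<noteq> {} \<and>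
     (\<forall>A B. closedin T A \<and> closedin T B \<and> Z \<subseteq> A \<union> B \<longrightarrow> Z \<subseteq> A \<or> Z \<subseteq> B)"

text \<open>
  Krull dimension of a nonempty space: the supremum of the lengths \<open>r\<close> of the chains
  \<open>C 0 \<subset> \<dots> \<subset> C r\<close> of irreducible closed subsets. (The empty space gets dimension 0.)
\<close>

definition krull_dim :: "'a topology \<Rightarrow> enat" where
  "krull_dim T = Sup {enat r | r. \<exists>C :: nat \<Rightarrow> 'a set.
     (\<forall>i\<le>r. closedin T (C i) \<and> irreducible_in T (C i)) \<and> (\<forall>i<r. C i \<subset> C (Suc i))}"

definition variety_dim :: "nat \<Rightarrow> 'b::field vec set \<Rightarrow> enat" where
  "variety_dim n V = krull_dim (subtopology (zariski UNIV n) V)"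

definition morphism_over ::
  "'b::field set \<Rightarrow> nat \<Rightarrow> 'b vec set \<Rightarrow> nat \<Rightarrow> 'b vec set \<Rightarrow> ('b vec \<Rightarrow> 'b vec) \<Rightarrow> bool" where
  "morphism_over K m V n W f \<longleftrightarrow> f ` V \<subseteq> W \<and>
     (\<exists>p. (\<forall>i<n. p i \<in> polyfun K m) \<and> (\<forall>x\<in>V. f x = vec n (\<lambda>i. p i x)))"

text \<open>Products of affine varieties, inside affine space of dimension \<open>m + n\<close>.\<close>

definition vec_prod :: "'b vec set \<Rightarrow> 'b vec set \<Rightarrow> 'b vec set" where
  "vec_prod V W = {x @\<^sub>v y | x y. x \<in> V \<and> y \<in> W}"

text \<open>
  Affine algebraic groups over \<open>K\<close>. Reductive groups are affine by definition, so no other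
  algebraic groups are needed.
\<close>

definition algebraic_group :: "'b::field set \<Rightarrow> nat \<Rightarrow> 'b vec monoid \<Rightarrow> bool" where
  "algebraic_group K m G \<longleftrightarrow> group G \<and>
     closedin (zariski K m) (carrier G) \<and>
     (\<forall>i<m. \<one>\<^bsub>G\<^esub> $ i \<in> K) \<and>
     morphism_over K (m + m) (vec_prod (carrier G) (carrier G)) m (carrier G)
       (\<lambda>w. vec_first w m \<otimes>\<^bsub>G\<^esub> vec_last w m) \<and>
     morphism_over K m (carrier G) m (carrier G) (\<lambda>x. inv\<^bsub>G\<^esub> x)"

text \<open>
  An element \<open>g\<close> is unipotent if right translation by \<open>g\<close> is a (locally) unipotent operator on
  the algebra of regular functions on \<open>G\<close> over the algebraic closure.
\<close>

definition unipotent_element :: "nat \<Rightarrow> 'b::field vec monoid \<Rightarrow> 'b vec \<Rightarrow> bool" where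
  "unipotent_element m G g \<longleftrightarrow> g \<in> carrier G \<and>
     (\<forall>f \<in> polyfun UNIV m. \<exists>N. \<forall>x \<in> carrier G.
        ((\<lambda>h y. h (y \<otimes>\<^bsub>G\<^esub> g) - h y) ^^ N) f x = 0)"

text \<open>
  The unipotent radical is the largest connected normal unipotent closed subgroup, which is the
  union of all of them. Here subgroups are taken over the algebraic closure.
\<close>

definition unipotent_radical :: "nat \<Rightarrow> 'b::field vec monoid \<Rightarrow> 'b vec set" where
  "unipotent_radical m G = \<Union>{U. U \<lhd> G \<and> closedin (zariski UNIV m) U \<and>
     connectedin (zariski UNIV m) U \<and> (\<forall>u\<in>U. unipotent_element m G u)}"

definition reductive :: "nat \<Rightarrow> 'b::field vec monoid \<Rightarrow> bool" where
  "reductive m G \<longleftrightarrow> unipotent_radical m G = {\<one>\<^bsub>G\<^esub>}"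

text \<open>
  The library's \<open>group_action\<close> requires each \<open>\<mu> g\<close> to be extensional, i.e.\ to have the value
  \<open>undefined\<close> outside of \<open>carrier_vec n\<close>; this does not affect its values on affine space.
\<close>

definition algebraic_action ::
  "'b::field set \<Rightarrow> nat \<Rightarrow> 'b vec monoid \<Rightarrow> nat \<Rightarrow> ('b vec \<Rightarrow> 'b vec \<Rightarrow> 'b vec) \<Rightarrow> bool" where
  "algebraic_action K m G n \<mu> \<longleftrightarrow> group_action G (carrier_vec n) \<mu> \<and>
     morphism_over K (m + n) (vec_prod (carrier G) (carrier_vec n)) n (carrier_vec n)
       (\<lambda>w. \<mu> (vec_first w m) (vec_last w n))"

definition affine_space_automorphism :: "'b::field set \<Rightarrow> nat \<Rightarrow> ('b vec \<Rightarrow> 'b vec) \<Rightarrow> bool" where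
  "affine_space_automorphism K n \<phi> \<longleftrightarrow> bij_betw \<phi> (carrier_vec n) (carrier_vec n) \<and>
     morphism_over K n (carrier_vec n) n (carrier_vec n) \<phi> \<and>
     morphism_over K n (carrier_vec n) n (carrier_vec n) (inv_into (carrier_vec n) \<phi>)"

definition linear_on_vec :: "nat \<Rightarrow> ('b::field vec \<Rightarrow> 'b vec) \<Rightarrow> bool" where
  "linear_on_vec n L \<longleftrightarrow>
     (\<forall>v\<in>carrier_vec n. L v \<in> carrier_vec n) \<and>
     (\<forall>v\<in>carrier_vec n. \<forall>w\<in>carrier_vec n. L (v + w) = L v + L w) \<and>
     (\<forall>c. \<forall>v\<in>carrier_vec n. L (c \<cdot>\<^sub>v v) = c \<cdot>\<^sub>v L v)"

definition linearizable ::
  "'b::field set \<Rightarrow> 'b vec monoid \<Rightarrow> nat \<Rightarrow> ('b vec \<Rightarrow> 'b vec \<Rightarrow> 'b vec) \<Rightarrow> bool" where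
  "linearizable K G n \<mu> \<longleftrightarrow> (\<exists>\<phi>. affine_space_automorphism K n \<phi> \<and>
     (\<forall>g\<in>carrier G. linear_on_vec n (\<lambda>v. \<phi> (\<mu> g (inv_into (carrier_vec n) \<phi> v)))))"

end

theory Submission
  imports Defs
begin

text \<open>
  Let \<open>s\<close> be a square root of \<open>\<alpha>\<close>. The group is the norm-one torus \<open>a\<^sup>2 - \<alpha> * b\<^sup>2 = 1\<close>: over the
  algebraic closure it is the multiplicative group with coordinate \<open>l = a + s * b\<close>, and \<open>a - s * b\<close> is
  both the inverse and the Galois conjugate of \<open>l\<close>. Hence its representations over the ground field
  have weights in pairs \<open>n, -n\<close>, and a weight vector for \<open>-n\<close> is the conjugate of one for \<open>n\<close>. Galois
  conjugation thus plays the role of the reflections in \<open>O(2)\<close>, and the idea behind the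
  nonlinearizable actions of \<open>O(2)\<close> on four-space, nontrivial equivariant vector bundles, applies.

  The action is on the total space of a bundle of rank two over the plane with coordinates \<open>z, w\<close> of
  weights \<open>2, -2\<close>. Away from \<open>z * w = 0\<close> it is the trivial bundle with fibre coordinates \<open>u, v\<close> of
  weights \<open>3, -3\<close>; along the two axes it is modified by the conditions that \<open>w\<close> divides \<open>u - z^3 * v\<close>
  and \<open>z\<close> divides \<open>v - w^3 * u\<close>. A nonequivariant basis of sections is given by polynomials over the
  ground field, with dual coordinates \<open>p, q\<close> such that \<open>u = w * p - z * (z - w) * (w^2 * p - z^2 * q)\<close>
  (\<open>ucoord\<close>). So the total space is affine four-space, and the action is polynomial in these coordinates
  (\<open>fibre_act\<close>, \<open>algebraic_action_torus_act\<close>). The tangent weights at the origin are \<open>2, -2, 5, -5\<close>.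

  A linearization yields a polynomial map over the ground field that is equivariant for the linear
  action with these weights and has injective differential everywhere. Its differential in the fibre
  directions, along the line \<open>z = w = x\<close>, consists of a linear form \<open>A(x) * p + B(x) * q\<close> of weight 5 and the
  conjugate form \<open>B'(x) * p + A'(x) * q\<close> of weight \<open>-5\<close>. The determinant \<open>A * A' - B * B'\<close> has no
  zero, so it is constant. An element of order four in the torus shows that \<open>A\<close> is even and \<open>B\<close> is odd. As \<open>\<alpha>\<close>
  is not a square, the conjugate of a nonzero coefficient is nonzero, and the even degree of \<open>A\<close>
  against the odd degree of \<open>B\<close> excludes cancellation of leading terms in the determinant
  (\<open>norm_difference_const\<close>): \<open>A\<close> is constant and \<open>B\<close> is 0. Transported by the torus, the form of weight 5 is
  a nonzero multiple of \<open>u / w\<close>, which is not polynomial (\<open>no_equivariant_immersion\<close>).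
\<close>

(* The symbol $ is reserved for the entries of vectors. *)
no_notation fps_nth (infixl "$" 75)

section \<open>Derivatives of polynomial functions\<close>

text \<open>
  Differentiation is done along polynomial curves. That a curve has a given value and derivative
  at 0 is a congruence modulo the square of the parameter, so sums and products can be
  differentiated without any limit.
\<close>

definition jet :: "('b::field_char_0 \<Rightarrow> 'b) \<Rightarrow> 'b \<Rightarrow> 'b \<Rightarrow> bool" where
  "jet c a b \<longleftrightarrow> (\<exists>r. \<forall>e. c e = a + e * b + e\<^sup>2 * poly r e)"

lemma jet_affine: "jet (\<lambda>e. a + e * b) a b"
  unfolding jet_def by (intro exI[of _ 0]) simp

lemma jet_const: "jet (\<lambda>e. a) a 0"
  using jet_affine[of a 0] by simp

lemma jet_add:
  assumes "jet c a b" "jet d a' b'"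
  shows "jet (\<lambda>e. c e + d e) (a + a') (b + b')"
proof -
  obtain r r' where r: "\<And>e. c e = a + e * b + e\<^sup>2 * poly r e"
      "\<And>e. d e = a' + e * b' + e\<^sup>2 * poly r' e"
    using assms unfolding jet_def by metis
  show ?thesis unfolding jet_def r
    by (intro exI[of _ "r + r'"]) (simp add: algebra_simps)
qed

lemma jet_mult:
  assumes "jet c a b" "jet d a' b'"
  shows "jet (\<lambda>e. c e * d e) (a * a') (a * b' + b * a')"
proof -
  obtain r r' where r: "\<And>e. c e = a + e * b + e\<^sup>2 * poly r e"
      "\<And>e. d e = a' + e * b' + e\<^sup>2 * poly r' e"
    using assms unfolding jet_def by metis
  show ?thesis unfolding jet_def r
    by (intro exI[of _ "[:b * b':] + smult a r' + smult a' r + [:0, 1:] * (smult b r' + smult b' r)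
          + [:0, 1:]\<^sup>2 * r * r'"])
       (simp add: algebra_simps power2_eq_square)
qed

lemma jet_cmult: "jet c a b \<Longrightarrow> jet (\<lambda>e. k * c e) (k * a) (k * b)"
  using jet_mult[OF jet_const[of k]] by fastforce

lemma jet_diff:
  assumes "jet c a b" "jet d a' b'"
  shows "jet (\<lambda>e. c e - d e) (a - a') (b - b')"
  using jet_add[OF assms(1) jet_cmult[OF assms(2), of "- 1"]] by simp

lemma poly_eq_of_agree:
  fixes p q :: "'b::field_char_0 poly"
  assumes "\<And>x. x \<noteq> c \<Longrightarrow> poly p x = poly q x"
  shows "p = q"
proof (rule ccontr)
  assume "p \<noteq> q"
  then have "finite {x. poly (p - q) x = 0}"
    by (intro poly_roots_finite) simp
  moreover have "UNIV - {c} \<subseteq> {x. poly (p - q) x = 0}"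
    using assms by auto
  ultimately have "finite (UNIV - {c})"
    by (rule rev_finite_subset)
  then show False
    using infinite_UNIV_char_0[where 'a='b] by simp
qed

lemma jet_unique:
  assumes "jet c a b" "jet c a' b'"
  shows "a = a'" "b = b'"
proof -
  obtain r r' where r: "\<And>e. c e = a + e * b + e\<^sup>2 * poly r e"
      "\<And>e. c e = a' + e * b' + e\<^sup>2 * poly r' e"
    using assms unfolding jet_def by metis
  have "pCons a (pCons b r) = pCons a' (pCons b' r')"
  proof (rule poly_eq_of_agree[of 0])
    fix e
    have "poly (pCons a (pCons b r)) e = c e"
      using r(1)[of e] by (simp add: algebra_simps power2_eq_square)
    moreover have "poly (pCons a' (pCons b' r')) e = c e"
      using r(2)[of e] by (simp add: algebra_simps power2_eq_square)
    ultimately show "poly (pCons a (pCons b r)) e = poly (pCons a' (pCons b' r')) e" by simp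
  qed
  then show "a = a'" "b = b'" by simp_all
qed

definition vjet :: "nat \<Rightarrow> ('b::field_char_0 \<Rightarrow> 'b vec) \<Rightarrow> 'b vec \<Rightarrow> 'b vec \<Rightarrow> bool" where
  "vjet n c a b \<longleftrightarrow> (\<forall>i<n. jet (\<lambda>e. c e $ i) (a $ i) (b $ i))"

lemma vjet_line:
  assumes "a \<in> carrier_vec n" "b \<in> carrier_vec n"
  shows "vjet n (\<lambda>e. a + e \<cdot>\<^sub>v b) a b"
  unfolding vjet_def using assms jet_affine by auto

lemma vjet_unique:
  assumes "vjet n c a b" "vjet n c a' b'" "b \<in> carrier_vec n" "b' \<in> carrier_vec n"
  shows "b = b'"
proof (rule eq_vecI)
  fix i assume "i < dim_vec b'"
  then have "i < n" using assms(4) by simp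
  then show "b $ i = b' $ i"
    using assms(1,2) jet_unique(2)[of "\<lambda>e. c e $ i"] unfolding vjet_def by blast
qed (use assms in simp)

text \<open>
  A gradient is characterized by the chain rule along every curve, rather than by partial
  derivatives, because the chain rule is all that is used of it.
\<close>

definition is_gradient :: "nat \<Rightarrow> ('b::field_char_0 vec \<Rightarrow> 'b) \<Rightarrow> (nat \<Rightarrow> 'b vec \<Rightarrow> 'b) \<Rightarrow> bool" where
  "is_gradient n f D \<longleftrightarrow> (\<forall>c a b. vjet n c a b \<longrightarrow>
     jet (\<lambda>e. f (c e)) (f a) (\<Sum>i<n. D i a * b $ i))"

lemma polyfun_gradient:
  assumes "f \<in> polyfun K n" "0 \<in> K" "1 \<in> K"
  shows "\<exists>D. (\<forall>i<n. D i \<in> polyfun K n) \<and> is_gradient n f D"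
  using assms(1)
proof induction
  case (const c)
  show ?case
    by (intro exI[of _ "\<lambda>i x. 0"]) (auto simp: is_gradient_def jet_const assms intro: polyfun.const)
next
  case (coord j)
  have *: "(\<Sum>i<n. (if i = j then 1 else 0) * b $ i) = b $ j" for b :: "'a vec"
    using coord by (simp add: if_distrib[of "\<lambda>x. x * _"] cong: if_cong)
  show ?case
    by (intro exI[of _ "\<lambda>i x. if i = j then 1 else 0"])
       (use coord in \<open>auto simp: is_gradient_def vjet_def * assms intro: polyfun.const\<close>)
next
  case (add f g)
  then obtain D E where "\<forall>i<n. D i \<in> polyfun K n" "is_gradient n f D"
     "\<forall>i<n. E i \<in> polyfun K n" "is_gradient n g E" by metis
  then show ?case
    by (intro exI[of _ "\<lambda>i x. D i x + E i x"])
       (auto simp: is_gradient_def distrib_right sum.distrib intro!: polyfun.add jet_add)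
next
  case (mult f g)
  then obtain D E where DE: "\<forall>i<n. D i \<in> polyfun K n" "is_gradient n f D"
     "\<forall>i<n. E i \<in> polyfun K n" "is_gradient n g E" by metis
  have *: "(\<Sum>i<n. (f a * E i a + D i a * g a) * b $ i) =
      f a * (\<Sum>i<n. E i a * b $ i) + (\<Sum>i<n. D i a * b $ i) * g a" for a b
    by (simp add: sum_distrib_left sum_distrib_right algebra_simps sum.distrib)
  from DE show ?case
    by (intro exI[of _ "\<lambda>i x. f x * E i x + D i x * g x"])
       (auto simp: is_gradient_def * intro!: polyfun.add polyfun.mult mult.hyps jet_mult)
qed

lemma polyfun_gradients:
  assumes "\<forall>j<k. f j \<in> polyfun K n" "0 \<in> K" "1 \<in> K"
  obtains D where "\<And>i j. j < k \<Longrightarrow> i < n \<Longrightarrow> D j i \<in> polyfun K n" "\<And>j. j < k \<Longrightarrow> is_gradient n (f j) (D j)"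
proof -
  have "\<forall>j. \<exists>D. j < k \<longrightarrow> (\<forall>i<n. D i \<in> polyfun K n) \<and> is_gradient n (f j) D"
    using polyfun_gradient[OF _ assms(2,3)] assms(1) by blast
  then obtain D where "\<forall>j. j < k \<longrightarrow> (\<forall>i<n. D j i \<in> polyfun K n) \<and> is_gradient n (f j) (D j)"
    by metis
  then show ?thesis using that by blast
qed

lemma vjet_map:
  assumes "\<And>j. j < k \<Longrightarrow> is_gradient n (f j) (D j)" "vjet n c a b"
  shows "vjet k (\<lambda>e. vec k (\<lambda>j. f j (c e))) (vec k (\<lambda>j. f j a)) (vec k (\<lambda>j. \<Sum>i<n. D j i a * b $ i))"
  using assms unfolding is_gradient_def vjet_def[of k] by simp

text \<open>
  This is how statements about functions in several variables are reduced to univariate polynomials,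
  for which degrees and roots are available; the coefficients stay in \<open>K\<close>.
\<close>

lemma polyfun_on_poly_curve:
  assumes "f \<in> polyfun K n"
    and curve: "\<forall>i<n. \<exists>P. (\<forall>k. coeff P k \<in> K) \<and> (\<forall>x. c x $ i = poly P x)"
    and K: "0 \<in> K" "\<And>a b. a \<in> K \<Longrightarrow> b \<in> K \<Longrightarrow> a + b \<in> K" "\<And>a b. a \<in> K \<Longrightarrow> b \<in> K \<Longrightarrow> a * b \<in> K"
  shows "\<exists>P. (\<forall>k. coeff P k \<in> K) \<and> (\<forall>x. f (c x) = poly P x)"
  using assms(1)
proof induction
  case (const a)
  then show ?case
    by (intro exI[of _ "[:a:]"]) (auto simp: coeff_pCons K split: nat.split)
next
  case (coord i)
  then show ?case using curve by blast
next
  case (add f g)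
  then obtain P Q where "\<forall>k. coeff P k \<in> K" "\<forall>x. f (c x) = poly P x"
      "\<forall>k. coeff Q k \<in> K" "\<forall>x. g (c x) = poly Q x" by metis
  then show ?case by (intro exI[of _ "P + Q"]) (auto simp: K)
next
  case (mult f g)
  then obtain P Q where "\<forall>k. coeff P k \<in> K" "\<forall>x. f (c x) = poly P x"
      "\<forall>k. coeff Q k \<in> K" "\<forall>x. g (c x) = poly Q x" by metis
  moreover have "sum h A \<in> K" if "\<And>i. i \<in> A \<Longrightarrow> h i \<in> K" for h and A :: "nat set"
    using that by (induction A rule: infinite_finite_induct) (auto simp: K)
  ultimately show ?case by (intro exI[of _ "P * Q"]) (auto simp: K coeff_mult)
qed

section \<open>Conjugate polynomials and norms\<close>

text \<open>
  The arithmetic core. If \<open>A'\<close> and \<open>B'\<close> are conjugate to \<open>A\<close> and \<open>B\<close>, the conjugate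
  of a leading coefficient is again nonzero, so that \<open>A * A'\<close> has twice the degree of \<open>A\<close> and
  \<open>B * B'\<close> twice the degree of \<open>B\<close>. The degree of \<open>A\<close> is even and that of \<open>B\<close> is odd, so the two degrees
  differ and the leading terms cannot cancel.
\<close>

lemma norm_difference_const:
  fixes A A' B B' :: "'b::field poly"
  assumes conj: "\<And>n. coeff A' n = 0 \<longleftrightarrow> coeff A n = 0" "\<And>n. coeff B' n = 0 \<longleftrightarrow> coeff B n = 0"
    and even: "\<And>n. odd n \<Longrightarrow> coeff A n = 0" and odd: "\<And>n. even n \<Longrightarrow> coeff B n = 0"
    and const: "degree (A * A' - B * B') = 0"
  shows "degree A = 0" "B = 0"
proof -
  have deg: "degree A' = degree A" "degree B' = degree B"
    unfolding degree_def conj by simp_all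
  have evenA: "even (degree A)"
    using even[of "degree A"] by (cases "A = 0") auto
  have oddB: "odd (degree B)" if "B \<noteq> 0"
    using odd[of "degree B"] that by auto
  have dAA: "degree (A * A') = 2 * degree A" if "A \<noteq> 0"
  proof -
    have "A' \<noteq> 0" using conj(1) that by (metis leading_coeff_0_iff coeff_0)
    then show ?thesis using that by (simp add: degree_mult_eq deg)
  qed
  have dBB: "degree (B * B') = 2 * degree B" if "B \<noteq> 0"
  proof -
    have "B' \<noteq> 0" using conj(2) that by (metis leading_coeff_0_iff coeff_0)
    then show ?thesis using that by (simp add: degree_mult_eq deg)
  qed
  show B: "B = 0"
  proof (rule ccontr)
    assume B: "B \<noteq> 0"
    then have pos: "degree (B * B') > 0" using oddB dBB by (cases "degree B") auto
    have "degree (A * A') \<noteq> degree (B * B')"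
      using dAA dBB[OF B] evenA oddB[OF B] by (cases "A = 0") (auto elim: oddE)
    then have "degree (A * A' - B * B') \<noteq> 0"
    proof (cases "degree (A * A') < degree (B * B')")
      case True
      then show ?thesis using pos degree_add_eq_right[of "A * A'" "- (B * B')"] by simp
    next
      case False
      then have "degree (B * B') < degree (A * A')" using \<open>degree (A * A') \<noteq> degree (B * B')\<close> by simp
      then show ?thesis using pos degree_add_eq_left[of "- (B * B')" "A * A'"] by simp
    qed
    then show False using const by simp
  qed
  show "degree A = 0"
    using const dAA unfolding B by (cases "A = 0") auto
qed

section \<open>The bundle in split coordinates\<close>

text \<open>
  The plane with coordinates \<open>(z, w)\<close> of weights \<open>\<plusminus>2\<close> carries the bundle with fibre coordinates
  \<open>(u, v)\<close> of weights \<open>\<plusminus>3\<close>. Its sections such that \<open>w\<close> divides \<open>u - z\<^sup>3 * v\<close> and \<open>z\<close> divides \<open>v - w\<^sup>3 * u\<close>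
  are again a free module. In coordinates \<open>(p, q)\<close> with respect to a suitable basis, \<open>u\<close> is
  \<open>ucoord z w p q\<close> and \<open>v\<close> is \<open>ucoord w z q p\<close>; the determinant of this change of coordinates is
  \<open>z * w\<close>.
\<close>

definition ucoord :: "'b::field \<Rightarrow> 'b \<Rightarrow> 'b \<Rightarrow> 'b \<Rightarrow> 'b" where
  "ucoord z w p q = w * p - z * (z - w) * (w\<^sup>2 * p - z\<^sup>2 * q)"

text \<open>
  The new value of \<open>p\<close> under the element \<open>l\<close> of the multiplicative group that maps
  \<open>(z, w, u, v)\<close> to \<open>(l^2 * z, w / l^2, l^3 * u, v / l^3)\<close>. A priori it is a quotient by \<open>w\<close>; the
  division has been carried out, since the divisibility condition on sections is equivariant.
\<close>

definition fibre_act :: "'b::field \<Rightarrow> 'b \<Rightarrow> 'b \<Rightarrow> 'b \<Rightarrow> 'b \<Rightarrow> 'b" where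
  "fibre_act l z w p q = l^5 * p + z * ((l^7 - l^5) * z * ucoord z w p q +
     (l^5 - l^3) * w * ucoord z w p q - (l^5 - l) * z * ucoord w z q p)"

lemma ucoord_diff: "w * ucoord z w p q - z * ucoord w z q p = w\<^sup>2 * p - z\<^sup>2 * q"
  unfolding ucoord_def by Groebner_Basis.algebra

text \<open>
  This is the identity that defines \<open>fibre_act\<close>, before the division: the right-hand side expresses
  the new value of \<open>p\<close>, multiplied by the new value of \<open>w\<close>, through the new values of \<open>u\<close> and \<open>v\<close>.
\<close>

lemma fibre_act_times:
  assumes "l * m = 1"
  shows "m\<^sup>2 * w * fibre_act l z w p q = l^3 * ucoord z w p q
    + l\<^sup>2 * z * (l\<^sup>2 * z - m\<^sup>2 * w) * (l * w * ucoord z w p q - m * z * ucoord w z q p)"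
proof -
  have "m\<^sup>2 * w * (l^5 * p + z * ((l^7 - l^5) * z * u + (l^5 - l^3) * w * u - (l^5 - l) * z * v)) = l^3 * u
    + l\<^sup>2 * z * (l\<^sup>2 * z - m\<^sup>2 * w) * (l * w * u - m * z * v)"
   if "u = w * p - z * (z - w) * (w * u - z * v)" for u v
    using that assms by Groebner_Basis.algebra
  then show ?thesis unfolding fibre_act_def using ucoord_diff[of w z p q]
    by (simp add: ucoord_def)
qed

lemma ucoord_act:
  assumes "l * m = 1"
  shows "ucoord (l\<^sup>2*z) (m\<^sup>2*w) (fibre_act l z w p q) (fibre_act m w z q p) = l^3 * ucoord z w p q"
proof -
  have ml: "m * l = 1" using assms by (simp add: mult.commute)
  note 1 = fibre_act_times[OF assms, of w z p q]
  note 2 = fibre_act_times[OF ml, of z w q p]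
  have "m\<^sup>2*w*x - l\<^sup>2*z*(l\<^sup>2*z-m\<^sup>2*w)*((m\<^sup>2*w)\<^sup>2*x-(l\<^sup>2*z)\<^sup>2*y) = l^3 * u"
    if "m\<^sup>2 * w * x = l^3 * u + l\<^sup>2 * z * (l\<^sup>2 * z - m\<^sup>2 * w) * (l * w * u - m * z * v)"
      "l\<^sup>2 * z * y = m^3 * v + m\<^sup>2 * w * (m\<^sup>2 * w - l\<^sup>2 * z) * (m * z * v - l * w * u)" for x y u v
  proof -
    have "(m\<^sup>2*w)\<^sup>2*x-(l\<^sup>2*z)\<^sup>2*y = (m\<^sup>2*w)*(m\<^sup>2*w*x)-(l\<^sup>2*z)*(l\<^sup>2*z*y)" by Groebner_Basis.algebra
    also have "\<dots> = l * w * u - m * z * v" unfolding that using assms by Groebner_Basis.algebra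
    finally show ?thesis using that(1) by Groebner_Basis.algebra
  qed
  from this[OF 1 2] show ?thesis unfolding ucoord_def[of "l\<^sup>2*z"] .
qed

text \<open>
  The new value of \<open>p\<close> depends only on \<open>p\<close> and the coordinates \<open>z, w, u, v\<close>, all of which
  except \<open>p\<close> are merely scaled by the group.
\<close>

lemma fibre_act_mult:
  assumes "l * m = 1"
  shows "fibre_act k (l\<^sup>2*z) (m\<^sup>2*w) (fibre_act l z w p q) (fibre_act m w z q p) = fibre_act (k*l) z w p q"
proof -
  have ml: "m * l = 1" using assms by (simp add: mult.commute)
  show ?thesis unfolding fibre_act_def[of k] fibre_act_def[of "k*l"] ucoord_act[OF assms] ucoord_act[OF ml]
    unfolding fibre_act_def[of l] using assms by Groebner_Basis.algebra
qed

section \<open>Quadratic extensions\<close>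

locale quadratic_extension =
  fixes \<alpha> :: "'k::field_char_0" and s :: "'k alg_closure"
  assumes s_square: "s\<^sup>2 = to_ac \<alpha>" and nonsquare: "\<nexists>\<beta>. \<alpha> = \<beta>\<^sup>2"
begin

lemma ground_closed:
  "0 \<in> (ground_field :: 'k alg_closure set)" "1 \<in> (ground_field :: 'k alg_closure set)"
  "numeral n \<in> (ground_field :: 'k alg_closure set)"
  "a \<in> ground_field \<Longrightarrow> b \<in> ground_field \<Longrightarrow> a + b \<in> (ground_field :: 'k alg_closure set)"
  "a \<in> ground_field \<Longrightarrow> b \<in> ground_field \<Longrightarrow> a * b \<in> (ground_field :: 'k alg_closure set)"
  "a \<in> ground_field \<Longrightarrow> - a \<in> (ground_field :: 'k alg_closure set)"
  "a \<in> ground_field \<Longrightarrow> b \<in> ground_field \<Longrightarrow> a / b \<in> (ground_field :: 'k alg_closure set)"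
        apply (metis rangeI to_ac_0)
       apply (metis rangeI to_ac_1)
      apply (metis rangeI to_ac_numeral)
  by (auto simp flip: to_ac_add to_ac_mult to_ac_minus to_ac_divide)

lemma ground_alpha: "to_ac \<alpha> \<in> ground_field" "s * s = to_ac \<alpha>"
  using s_square by (auto simp: power2_eq_square)

lemma s_notin_ground: "s \<notin> ground_field"
proof
  assume "s \<in> ground_field"
  then obtain \<beta> where "s = to_ac \<beta>" by blast
  then have "to_ac (\<beta>\<^sup>2) = to_ac \<alpha>" using s_square by simp
  then show False using nonsquare by (metis to_ac_eq_iff)
qed

lemma s_nonzero [simp]: "s \<noteq> 0"
  using s_notin_ground ground_closed(1) by metis

lemma independent_1_s:
  assumes "a \<in> ground_field" "b \<in> ground_field" "a + s * b = 0"
  shows "a = 0" "b = 0"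
proof -
  show "b = 0"
  proof (rule ccontr)
    assume "b \<noteq> 0"
    then have "s = - a / b" using assms(3) by (simp add: field_simps eq_neg_iff_add_eq_0)
    then show False using s_notin_ground assms ground_closed by metis
  qed
  then show "a = 0" using assms(3) by simp
qed

text \<open>
  Split coordinates: over the algebraic closure, the conjugate linear forms \<open>a + s * b\<close> and \<open>a - s * b\<close>
  in consecutive entries \<open>a, b\<close> diagonalize the group and its linear representations used below.
\<close>

definition split_pos :: "'k alg_closure vec \<Rightarrow> nat \<Rightarrow> 'k alg_closure" where
  "split_pos v i = v $ i + s * v $ Suc i"

definition split_neg :: "'k alg_closure vec \<Rightarrow> nat \<Rightarrow> 'k alg_closure" where
  "split_neg v i = v $ i - s * v $ Suc i"

definition split_vec2 :: "'k alg_closure \<Rightarrow> 'k alg_closure \<Rightarrow> 'k alg_closure vec" where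
  "split_vec2 l m = vec_of_list [(l + m) / 2, (l - m) / (2 * s)]"

definition split_vec4 :: "'k alg_closure \<Rightarrow> 'k alg_closure \<Rightarrow> 'k alg_closure \<Rightarrow> 'k alg_closure \<Rightarrow> 'k alg_closure vec" where
  "split_vec4 z w p q = vec_of_list [(z + w) / 2, (z - w) / (2 * s), (p + q) / 2, (p - q) / (2 * s)]"

lemma split_vec2_index: "split_vec2 l m $ 0 = (l + m) / 2" "split_vec2 l m $ Suc 0 = (l - m) / (2 * s)"
  unfolding split_vec2_def vec_of_list_index by simp_all

lemma split_vec4_index: "split_vec4 z w p q $ 0 = (z + w) / 2" "split_vec4 z w p q $ Suc 0 = (z - w) / (2 * s)"
  "split_vec4 z w p q $ 2 = (p + q) / 2" "split_vec4 z w p q $ Suc 2 = (p - q) / (2 * s)"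
  unfolding split_vec4_def vec_of_list_index by (simp_all add: numeral_eq_Suc)

lemma dim_split_vec [simp]: "dim_vec (split_vec2 l m) = 2" "dim_vec (split_vec4 z w p q) = 4"
  unfolding split_vec2_def split_vec4_def by simp_all

lemma split_vec2_carrier [simp]: "split_vec2 l m \<in> carrier_vec 2"
  unfolding split_vec2_def by (rule carrier_vecI) simp

lemma split_vec4_carrier [simp]: "split_vec4 z w p q \<in> carrier_vec 4"
  unfolding split_vec4_def by (rule carrier_vecI) simp

lemma half_sum: "(x + y) / 2 + s * ((x - y) / (2 * s)) = x" "(x + y) / 2 - s * ((x - y) / (2 * s)) = y"
  by (simp_all add: field_simps)

lemma split_vec2_coords [simp]: "split_pos (split_vec2 l m) 0 = l" "split_neg (split_vec2 l m) 0 = m"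
  unfolding split_pos_def split_neg_def by (simp_all only: split_vec2_index half_sum)

lemma split_vec4_coords [simp]: "split_pos (split_vec4 z w p q) 0 = z" "split_neg (split_vec4 z w p q) 0 = w"
   "split_pos (split_vec4 z w p q) 2 = p" "split_neg (split_vec4 z w p q) 2 = q"
  unfolding split_pos_def split_neg_def by (simp_all only: split_vec4_index half_sum)

lemma half_diff: "((a + s * b) + (a - s * b)) / 2 = a" "((a + s * b) - (a - s * b)) / (2 * s) = b"
  by (simp_all add: field_simps)

lemma split_vec2_of_coords [simp]: "v \<in> carrier_vec 2 \<Longrightarrow> split_vec2 (split_pos v 0) (split_neg v 0) = v"
proof (rule eq_vecI)
  fix i assume "v \<in> carrier_vec 2" "i < dim_vec v"
  then have "i = 0 \<or> i = Suc 0" by auto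
  then show "split_vec2 (split_pos v 0) (split_neg v 0) $ i = v $ i"
    unfolding split_pos_def split_neg_def by (elim disjE) (simp_all only: split_vec2_index half_diff)
qed simp

lemma split_vec4_of_coords [simp]: "v \<in> carrier_vec 4 \<Longrightarrow> split_vec4 (split_pos v 0) (split_neg v 0) (split_pos v 2) (split_neg v 2) = v"
proof (rule eq_vecI)
  fix i assume "v \<in> carrier_vec 4" "i < dim_vec v"
  then have "i = 0 \<or> i = Suc 0 \<or> i = 2 \<or> i = Suc 2" by auto
  then show "split_vec4 (split_pos v 0) (split_neg v 0) (split_pos v 2) (split_neg v 2) $ i = v $ i"
    unfolding split_pos_def split_neg_def by (elim disjE) (simp_all only: split_vec4_index half_diff)
qed simp

text \<open>
  The Galois conjugation \<open>s \<mapsto> -s\<close> exchanges \<open>f\<close> and \<open>g\<close>. It acts on polynomials over the quadratic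
  extension only, and is therefore expressed by their two components over the ground field.
\<close>

definition conjugate :: "nat \<Rightarrow> ('k alg_closure vec \<Rightarrow> 'k alg_closure) \<Rightarrow> ('k alg_closure vec \<Rightarrow> 'k alg_closure) \<Rightarrow> bool" where
  "conjugate n f g \<longleftrightarrow> (\<exists>A \<in> polyfun ground_field n. \<exists>B \<in> polyfun ground_field n.
     (\<forall>x. f x = A x + s * B x) \<and> (\<forall>x. g x = A x - s * B x))"

lemma conjugateI:
  assumes "A \<in> polyfun ground_field n" "B \<in> polyfun ground_field n"
    "\<And>x. f x = A x + s * B x" "\<And>x. g x = A x - s * B x"
  shows "conjugate n f g"
  unfolding conjugate_def using assms by blast

lemma conjugate_coords:
  assumes "i < n" "j < n"
  shows "conjugate n (\<lambda>x. x $ i + s * x $ j) (\<lambda>x. x $ i - s * x $ j)"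
  by (rule conjugateI[OF polyfun.coord[OF assms(1)] polyfun.coord[OF assms(2)]]) simp_all

lemma conjugate_const:
  assumes "c \<in> ground_field"
  shows "conjugate n (\<lambda>x. c) (\<lambda>x. c)"
  by (rule conjugateI[OF polyfun.const[OF assms] polyfun.const[OF ground_closed(1)]]) simp_all

lemma conjugate_add:
  assumes "conjugate n f g" "conjugate n f' g'"
  shows "conjugate n (\<lambda>x. f x + f' x) (\<lambda>x. g x + g' x)"
proof -
  obtain A B A' B' where *: "A \<in> polyfun ground_field n" "B \<in> polyfun ground_field n"
    "A' \<in> polyfun ground_field n" "B' \<in> polyfun ground_field n"
    "\<And>x. f x = A x + s * B x" "\<And>x. g x = A x - s * B x"
    "\<And>x. f' x = A' x + s * B' x" "\<And>x. g' x = A' x - s * B' x"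
    using assms unfolding conjugate_def by metis
  show ?thesis
    by (rule conjugateI[OF polyfun.add[OF *(1,3)] polyfun.add[OF *(2,4)]]) (simp_all add: * algebra_simps)
qed

lemma conjugate_mult:
  assumes "conjugate n f g" "conjugate n f' g'"
  shows "conjugate n (\<lambda>x. f x * f' x) (\<lambda>x. g x * g' x)"
proof -
  obtain A B A' B' where *: "A \<in> polyfun ground_field n" "B \<in> polyfun ground_field n"
    "A' \<in> polyfun ground_field n" "B' \<in> polyfun ground_field n"
    "\<And>x. f x = A x + s * B x" "\<And>x. g x = A x - s * B x"
    "\<And>x. f' x = A' x + s * B' x" "\<And>x. g' x = A' x - s * B' x"
    using assms unfolding conjugate_def by metis
  have *: "(\<lambda>x. A x * A' x + to_ac \<alpha> * (B x * B' x)) \<in> polyfun ground_field n"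
    "(\<lambda>x. A x * B' x + B x * A' x) \<in> polyfun ground_field n"
    "\<And>x. f x = A x + s * B x" "\<And>x. g x = A x - s * B x"
    "\<And>x. f' x = A' x + s * B' x" "\<And>x. g' x = A' x - s * B' x"
    using * ground_alpha by (auto intro!: polyfun.add polyfun.mult polyfun.const)
  show ?thesis
    by (rule conjugateI[OF *(1,2)]) (simp_all add: *(3-) algebra_simps flip: ground_alpha(2))
qed

lemma conjugate_power: "conjugate n f g \<Longrightarrow> conjugate n (\<lambda>x. f x ^ k) (\<lambda>x. g x ^ k)"
  by (induction k) (simp_all add: conjugate_const conjugate_mult ground_closed)

lemma conjugate_diff:
  assumes "conjugate n f g" "conjugate n f' g'"
  shows "conjugate n (\<lambda>x. f x - f' x) (\<lambda>x. g x - g' x)"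
  using conjugate_add[OF assms(1) conjugate_mult[OF conjugate_const[of "- 1"] assms(2)]]
  by (simp add: ground_closed)

lemma conjugate_sym:
  assumes "conjugate n f g"
  shows "conjugate n g f"
proof -
  obtain A B where *: "A \<in> polyfun ground_field n" "B \<in> polyfun ground_field n"
    "\<And>x. f x = A x + s * B x" "\<And>x. g x = A x - s * B x"
    using assms unfolding conjugate_def by metis
  have "(\<lambda>x. - 1 * B x) \<in> polyfun ground_field n"
    using *(2) ground_closed(2,6) by (intro polyfun.mult polyfun.const) auto
  from conjugateI[OF *(1) this] show ?thesis by (simp add: *)
qed

text \<open>
  A map given in split coordinates by conjugate polynomials is thus defined over the ground field.
\<close>

lemma conjugate_components:
  assumes "conjugate n f g"
  shows "(\<lambda>x. (f x + g x) / 2) \<in> polyfun ground_field n"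
    "(\<lambda>x. (f x - g x) / (2 * s)) \<in> polyfun ground_field n"
proof -
  obtain A B where *: "A \<in> polyfun ground_field n" "B \<in> polyfun ground_field n"
    "\<And>x. f x = A x + s * B x" "\<And>x. g x = A x - s * B x"
    using assms unfolding conjugate_def by metis
  show "(\<lambda>x. (f x + g x) / 2) \<in> polyfun ground_field n"
    "(\<lambda>x. (f x - g x) / (2 * s)) \<in> polyfun ground_field n"
    unfolding *(3,4) half_diff using *(1,2) by auto
qed

lemma morphism_over_split_vec2:
  assumes "conjugate m f g" "\<And>x. x \<in> V \<Longrightarrow> F x = split_vec2 (f x) (g x)" "\<And>x. x \<in> V \<Longrightarrow> F x \<in> W"
  shows "morphism_over ground_field m V 2 W F"
  unfolding morphism_over_def
proof (intro conjI exI[of _ "\<lambda>i x. if i = 0 then (f x + g x) / 2 else (f x - g x) / (2 * s)"] allI ballI impI)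
  fix i :: nat
  show "(\<lambda>x. if i = 0 then (f x + g x) / 2 else (f x - g x) / (2 * s)) \<in> polyfun ground_field m"
    using conjugate_components[OF assms(1)] by (cases "i = 0") simp_all
next
  fix x assume "x \<in> V"
  show "F x = vec 2 (\<lambda>i. if i = 0 then (f x + g x) / 2 else (f x - g x) / (2 * s))"
    unfolding assms(2)[OF \<open>x \<in> V\<close>]
    by (rule eq_vecI) (auto simp: less_2_cases_iff split_vec2_index)
qed (use assms(3) in auto)

lemma morphism_over_split_vec4:
  assumes "conjugate m f g" "conjugate m f' g'"
    "\<And>x. x \<in> V \<Longrightarrow> F x = split_vec4 (f x) (g x) (f' x) (g' x)" "\<And>x. x \<in> V \<Longrightarrow> F x \<in> W"
  shows "morphism_over ground_field m V 4 W F"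
  unfolding morphism_over_def
proof (intro conjI exI[of _ "\<lambda>i x. if i = 0 then (f x + g x) / 2 else if i = 1 then (f x - g x) / (2 * s)
      else if i = 2 then (f' x + g' x) / 2 else (f' x - g' x) / (2 * s)"] allI ballI impI)
  fix i :: nat
  show "(\<lambda>x. if i = 0 then (f x + g x) / 2 else if i = 1 then (f x - g x) / (2 * s)
      else if i = 2 then (f' x + g' x) / 2 else (f' x - g' x) / (2 * s)) \<in> polyfun ground_field m"
    using conjugate_components[OF assms(1)] conjugate_components[OF assms(2)]
    by (cases "i = 0"; cases "i = 1"; cases "i = 2") simp_all
next
  fix x assume "x \<in> V"
  have four: "i < 4 \<Longrightarrow> i = 0 \<or> i = Suc 0 \<or> i = 2 \<or> i = Suc 2" for i :: nat by auto
  show "F x = vec 4 (\<lambda>i. if i = 0 then (f x + g x) / 2 else if i = 1 then (f x - g x) / (2 * s)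
      else if i = 2 then (f' x + g' x) / 2 else (f' x - g' x) / (2 * s))"
    unfolding assms(3)[OF \<open>x \<in> V\<close>]
    by (rule eq_vecI) (auto dest!: four simp: split_vec4_index split_vec4_index(4)[simplified])
qed (use assms(4) in auto)

section \<open>The norm-one torus\<close>

text \<open>
  The norm-one torus \<open>a\<^sup>2 - \<alpha> * b\<^sup>2 = 1\<close>. Its elements are the \<open>a + s * b\<close> of norm 1, with the inverse
  \<open>a - s * b\<close>, and they are multiplied as such.
\<close>

definition torus :: "'k alg_closure vec monoid" where
  "torus = \<lparr>carrier = {v \<in> carrier_vec 2. split_pos v 0 * split_neg v 0 = 1},
     monoid.mult = (\<lambda>v w. split_vec2 (split_pos v 0 * split_pos w 0) (split_neg v 0 * split_neg w 0)), one = split_vec2 1 1\<rparr>"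

lemma torus_simps [simp]:
  "v \<in> carrier torus \<longleftrightarrow> v \<in> carrier_vec 2 \<and> split_pos v 0 * split_neg v 0 = 1"
  "v \<otimes>\<^bsub>torus\<^esub> w = split_vec2 (split_pos v 0 * split_pos w 0) (split_neg v 0 * split_neg w 0)"
  "\<one>\<^bsub>torus\<^esub> = split_vec2 1 1"
  unfolding torus_def by simp_all

lemma split_vec2_in_torus: "l * m = 1 \<Longrightarrow> split_vec2 l m \<in> carrier torus"
  by simp

lemma torus_subset: "carrier torus \<subseteq> carrier_vec 2"
  by auto

lemma comm_group_torus: "comm_group torus"
proof (rule comm_groupI)
  fix x y assume "x \<in> carrier torus" "y \<in> carrier torus"
  then show "x \<otimes>\<^bsub>torus\<^esub> y \<in> carrier torus"
    by simp (metis mult.assoc mult.left_commute mult_1)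
next
  fix x assume "x \<in> carrier torus"
  then show "\<exists>y \<in> carrier torus. y \<otimes>\<^bsub>torus\<^esub> x = \<one>\<^bsub>torus\<^esub>"
    by (intro bexI[of _ "split_vec2 (split_neg x 0) (split_pos x 0)"]) (simp_all add: mult.commute)
qed (simp_all add: mult_ac)

lemma group_torus: "group torus"
  using comm_group_torus by (simp add: comm_group_def)

lemma inv_torus:
  assumes "v \<in> carrier torus"
  shows "inv\<^bsub>torus\<^esub> v = split_vec2 (split_neg v 0) (split_pos v 0)"
  using assms by (intro group.inv_equality[OF group_torus]) (simp_all add: mult.commute)

lemma torus_closed: "closedin (zariski ground_field 2) (carrier torus)"
proof -
  have K: "1 \<in> (ground_field :: 'k alg_closure set)" "- to_ac \<alpha> \<in> ground_field"
      "- 1 \<in> (ground_field :: 'k alg_closure set)"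
    using ground_closed(2) ground_closed(6)[OF ground_alpha(1)] ground_closed(6)[OF ground_closed(2)]
    by simp_all
  let ?f = "\<lambda>x :: 'k alg_closure vec. (x $ 0 * x $ 0 + (- to_ac \<alpha>) * (x $ 1 * x $ 1)) + (- 1)"
  have "?f \<in> polyfun ground_field 2"
    using K by (intro polyfun.add polyfun.mult polyfun.const polyfun.coord) auto
  moreover have "?f x = split_pos x 0 * split_neg x 0 - 1" for x
    unfolding split_pos_def split_neg_def ground_alpha(2)[symmetric] by (simp add: algebra_simps)
  then have "carrier torus = zero_locus 2 {?f}"
    by (auto simp: zero_locus_def)
  ultimately show ?thesis
    unfolding closedin_zariski[OF K(1)] by (intro exI[of _ "{?f}"]) simp
qed

lemma vec_first_index: "i < n \<Longrightarrow> vec_first x n $ i = x $ i"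
  unfolding vec_first_def by simp

lemma vec_last_index: "x \<in> carrier_vec (m + n) \<Longrightarrow> i < n \<Longrightarrow> vec_last x n $ i = x $ (m + i)"
  unfolding vec_last_def by auto

lemma vec_prod_parts:
  assumes "x \<in> vec_prod V W" "V \<subseteq> carrier_vec m" "W \<subseteq> carrier_vec n"
  shows "x \<in> carrier_vec (m + n)" "vec_first x m \<in> V" "vec_last x n \<in> W"
proof -
  obtain a b where ab: "x = a @\<^sub>v b" "a \<in> V" "b \<in> W" "a \<in> carrier_vec m" "b \<in> carrier_vec n"
    using assms unfolding vec_prod_def by blast
  then have "vec_first x m = a" "vec_last x n = b"
    by (auto simp: vec_first_def vec_last_def)
  then show "x \<in> carrier_vec (m + n)" "vec_first x m \<in> V" "vec_last x n \<in> W"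
    using ab by auto
qed

lemma algebraic_group_torus: "algebraic_group ground_field 2 torus"
  unfolding algebraic_group_def
proof (intro conjI allI impI)
  fix i :: nat assume "i < 2"
  then show "\<one>\<^bsub>torus\<^esub> $ i \<in> ground_field"
    using ground_closed(1,2) by (auto simp: less_2_cases_iff split_vec2_index)
next
  show "morphism_over ground_field (2 + 2) (vec_prod (carrier torus) (carrier torus)) 2 (carrier torus)
      (\<lambda>w. vec_first w 2 \<otimes>\<^bsub>torus\<^esub> vec_last w 2)"
  proof (rule morphism_over_split_vec2)
    show "conjugate (2 + 2) (\<lambda>x. (x $ 0 + s * x $ 1) * (x $ 2 + s * x $ 3)) (\<lambda>x. (x $ 0 - s * x $ 1) * (x $ 2 - s * x $ 3))"
      by (intro conjugate_mult conjugate_coords) simp_all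
    fix x assume "x \<in> vec_prod (carrier torus) (carrier torus)"
    then have x: "x \<in> carrier_vec (2 + 2)" "vec_first x 2 \<in> carrier torus" "vec_last x 2 \<in> carrier torus"
      using vec_prod_parts[OF _ torus_subset torus_subset] by blast+
    have last: "vec_last x 2 $ 0 = x $ 2" "vec_last x 2 $ Suc 0 = x $ 3"
      using vec_last_index[OF x(1), of 0] vec_last_index[OF x(1), of 1] by simp_all
    show "vec_first x 2 \<otimes>\<^bsub>torus\<^esub> vec_last x 2 =
        split_vec2 ((x $ 0 + s * x $ 1) * (x $ 2 + s * x $ 3)) ((x $ 0 - s * x $ 1) * (x $ 2 - s * x $ 3))"
      by (simp add: split_pos_def split_neg_def vec_first_index last)
    show "vec_first x 2 \<otimes>\<^bsub>torus\<^esub> vec_last x 2 \<in> carrier torus"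
      using x(2,3) by (intro monoid.m_closed group.is_monoid group_torus)
  qed
next
  show "morphism_over ground_field 2 (carrier torus) 2 (carrier torus) (m_inv torus)"
  proof (rule morphism_over_split_vec2)
    show "conjugate 2 (\<lambda>x. x $ 0 - s * x $ 1) (\<lambda>x. x $ 0 + s * x $ 1)"
      by (intro conjugate_sym[OF conjugate_coords]) simp_all
    fix x assume x: "x \<in> carrier torus"
    show "inv\<^bsub>torus\<^esub> x = split_vec2 (x $ 0 - s * x $ 1) (x $ 0 + s * x $ 1)"
      unfolding inv_torus[OF x] by (simp add: split_pos_def split_neg_def)
    show "inv\<^bsub>torus\<^esub> x \<in> carrier torus"
      using x by (intro group.inv_closed group_torus)
  qed
qed (use group_torus torus_closed in auto)

text \<open>
  The torus is the multiplicative group over the algebraic closure, so its regular functions are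
  the Laurent polynomials in the coordinate \<open>l\<close>.
\<close>

lemma polyfun_on_torus:
  assumes "f \<in> polyfun UNIV 2"
  shows "\<exists>N P. \<forall>l m. l * m = 1 \<longrightarrow> l ^ N * f (split_vec2 l m) = poly P l"
  using assms
proof induction
  case (const c)
  show ?case by (intro exI[of _ 0] exI[of _ "[:c:]"]) simp
next
  case (coord i)
  have e: "l * (l + m) = 1 + l * l" "l * (l - m) = l * l - 1" if "l * m = 1" for l m :: "'k alg_closure"
    using that by (simp_all add: algebra_simps)
  show ?case
  proof (cases "i = 0")
    case True
    show ?thesis
      by (intro exI[of _ 1] exI[of _ "smult (1/2) [:1, 0, 1:]"])
        (use e(1) in \<open>simp add: True split_vec2_index\<close>)
  next
    case False
    then have i: "i = Suc 0" using coord by simp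
    have "l ^ 1 * split_vec2 l m $ i = poly (smult (1 / (2 * s)) [:-1, 0, 1:]) l" if "l * m = 1" for l m
    proof -
      have "l ^ 1 * split_vec2 l m $ i = (l * (l - m)) * (1 / (2 * s))"
        by (simp add: i split_vec2_index)
      also have "\<dots> = poly (smult (1 / (2 * s)) [:-1, 0, 1:]) l"
        unfolding e(2)[OF that] by (simp add: diff_divide_distrib)
      finally show ?thesis .
    qed
    then show ?thesis by blast
  qed
next
  case (add f g)
  then obtain N P N' P' where *: "\<And>l m. l * m = 1 \<Longrightarrow> l ^ N * f (split_vec2 l m) = poly P l"
     "\<And>l m. l * m = 1 \<Longrightarrow> l ^ N' * g (split_vec2 l m) = poly P' l" by metis
  have "l ^ (N + N') * (f (split_vec2 l m) + g (split_vec2 l m)) = poly (monom 1 N' * P + monom 1 N * P') l"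
    if "l * m = 1" for l m
    by (simp add: poly_monom *[OF that, symmetric] algebra_simps power_add)
  then show ?case by blast
next
  case (mult f g)
  then obtain N P N' P' where *: "\<And>l m. l * m = 1 \<Longrightarrow> l ^ N * f (split_vec2 l m) = poly P l"
     "\<And>l m. l * m = 1 \<Longrightarrow> l ^ N' * g (split_vec2 l m) = poly P' l" by metis
  have "l ^ (N + N') * (f (split_vec2 l m) * g (split_vec2 l m)) = poly (P * P') l"
    if "l * m = 1" for l m
    by (simp add: *[OF that, symmetric] algebra_simps power_add)
  then show ?case by blast
qed

text \<open>
  Proper closed subsets are finite because a nonzero Laurent polynomial has finitely many
  roots. Irreducibility, connectedness and dimension one all follow from this.
\<close>

lemma closed_in_torus_finite:
  assumes "closedin (zariski UNIV 2) Z" "\<not> carrier torus \<subseteq> Z"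
  shows "finite (Z \<inter> carrier torus)"
proof -
  obtain S where S: "S \<subseteq> polyfun UNIV 2" "Z = zero_locus 2 S"
    using assms(1) closedin_zariski[of UNIV 2 Z] by auto
  obtain v where "v \<in> carrier torus" "v \<notin> Z"
    using assms(2) by blast
  then obtain f where v: "v \<in> carrier torus" "f \<in> S" "f v \<noteq> 0"
    using torus_subset unfolding S(2) zero_locus_def by blast
  obtain N P where P: "\<And>l m. l * m = 1 \<Longrightarrow> l ^ N * f (split_vec2 l m) = poly P l"
    using polyfun_on_torus S(1) v(2) by blast
  have "P \<noteq> 0"
  proof
    assume "P = 0"
    then have "split_pos v 0 ^ N * f (split_vec2 (split_pos v 0) (split_neg v 0)) = 0"
      using P[of "split_pos v 0" "split_neg v 0"] v(1) by simp
    then show False using v by auto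
  qed
  have "Z \<inter> carrier torus \<subseteq> (\<lambda>l. split_vec2 l (1 / l)) ` {l. poly P l = 0}"
  proof
    fix x assume x: "x \<in> Z \<inter> carrier torus"
    then have "f x = 0" using v(2) unfolding S(2) zero_locus_def by blast
    then have "poly P (split_pos x 0) = 0" using P[of "split_pos x 0" "split_neg x 0"] x by simp
    moreover have "split_neg x 0 = 1 / split_pos x 0"
      using x torus_simps(1)[of x] by (metis IntD2 mult_zero_left nonzero_mult_div_cancel_left zero_neq_one)
    then have "x = split_vec2 (split_pos x 0) (1 / split_pos x 0)" using x split_vec2_of_coords[of x] by auto
    ultimately show "x \<in> (\<lambda>l. split_vec2 l (1 / l)) ` {l. poly P l = 0}" by blast
  qed
  then show ?thesis
    using poly_roots_finite[OF \<open>P \<noteq> 0\<close>] by (rule finite_surj[rotated])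
qed

lemma infinite_torus: "infinite (carrier torus)"
proof
  assume fin: "finite (carrier torus)"
  have "UNIV - {0} \<subseteq> (\<lambda>v. split_pos v 0) ` carrier torus"
  proof
    fix l :: "'k alg_closure" assume "l \<in> UNIV - {0}"
    then have "split_vec2 l (1 / l) \<in> carrier torus" by simp
    then show "l \<in> (\<lambda>v. split_pos v 0) ` carrier torus" by (metis image_eqI split_vec2_coords(1))
  qed
  then have "finite (UNIV - {0 :: 'k alg_closure})"
    using fin by (meson finite_imageI rev_finite_subset)
  then show False using infinite_UNIV_char_0[where 'a="'k alg_closure"] by simp
qed

lemma torus_not_union:
  assumes "closedin (zariski UNIV 2) A" "closedin (zariski UNIV 2) B" "carrier torus \<subseteq> A \<union> B"
  shows "carrier torus \<subseteq> A \<or> carrier torus \<subseteq> B"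
proof (rule ccontr)
  assume "\<not> ?thesis"
  then have "finite ((A \<inter> carrier torus) \<union> (B \<inter> carrier torus))"
    using closed_in_torus_finite assms(1,2) by blast
  moreover have "carrier torus = (A \<inter> carrier torus) \<union> (B \<inter> carrier torus)"
    using assms(3) by blast
  ultimately show False using infinite_torus by simp
qed

lemma topspace_zariski_UNIV: "topspace (zariski UNIV n) = carrier_vec n"
  by (rule topspace_zariski) simp

lemma torus_connected: "connectedin (zariski UNIV 2) (carrier torus)"
  unfolding connectedin_closedin topspace_zariski_UNIV
  using torus_not_union by auto

lemma closed_point:
  assumes "v \<in> carrier_vec n"
  shows "closedin (zariski UNIV n) {v}"
proof -
  let ?S = "(\<lambda>i x. x $ i + (- (v $ i))) ` {..<n}"
  have "?S \<subseteq> polyfun UNIV n"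
    by (intro image_subsetI polyfun.add polyfun.coord polyfun.const) simp_all
  moreover have "{v} = zero_locus n ?S"
    using assms by (auto simp: zero_locus_def intro!: eq_vecI)
  ultimately show ?thesis
    using closedin_zariski[of UNIV n "{v}"] by auto
qed

lemma torus_irreducible_closed:
  assumes "closedin (subtopology (zariski UNIV 2) (carrier torus)) C"
    "irreducible_in (subtopology (zariski UNIV 2) (carrier torus)) C"
  shows "C = carrier torus \<or> (\<exists>v. C = {v})"
proof (cases "C = carrier torus")
  case False
  let ?T = "subtopology (zariski UNIV 2) (carrier torus)"
  obtain Z where Z: "closedin (zariski UNIV 2) Z" "C = Z \<inter> carrier torus"
    using assms(1) unfolding closedin_subtopology by blast
  then have "finite C" using False closed_in_torus_finite by blast
  have cl: "closedin ?T {x}" if "x \<in> C" for x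
    using that Z(2) closed_point[of x 2] closedin_subtopology[of "zariski UNIV 2" "carrier torus" "{x}"]
    by auto
  obtain v where v: "v \<in> C" using assms(2) unfolding irreducible_in_def by blast
  have "closedin ?T (\<Union>((\<lambda>x. {x}) ` (C - {v})))"
    using cl \<open>finite C\<close> by (intro closedin_Union) auto
  then have "closedin ?T (C - {v})" by simp
  moreover have "C \<subseteq> {v} \<union> (C - {v})" by blast
  ultimately have "C \<subseteq> {v} \<or> C \<subseteq> C - {v}"
    using assms(2) cl[OF v] unfolding irreducible_in_def by blast
  then show ?thesis using v by blast
qed simp

text \<open>
  The point 1 inside the torus is a chain of length 1. In a longer chain the middle member would be a
  proper closed irreducible subset, hence a single point, and its predecessor would be empty.
\<close>

lemma torus_dim: "variety_dim 2 (carrier torus) = 1"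
proof -
  let ?T = "subtopology (zariski UNIV 2) (carrier torus)"
  have top: "topspace ?T = carrier torus"
    unfolding topspace_subtopology topspace_zariski_UNIV by auto
  let ?chain = "\<lambda>r (C :: nat \<Rightarrow> 'k alg_closure vec set).
     (\<forall>i\<le>r. closedin ?T (C i) \<and> irreducible_in ?T (C i)) \<and> (\<forall>i<r. C i \<subset> C (Suc i))"
  have le1: "r \<le> 1" if chain: "?chain r C" for r C
  proof (rule ccontr)
    have C: "\<And>i. i \<le> r \<Longrightarrow> closedin ?T (C i)" "\<And>i. i \<le> r \<Longrightarrow> irreducible_in ?T (C i)"
      "\<And>i. i < r \<Longrightarrow> C i \<subset> C (Suc i)"
      using chain by simp_all
    assume "\<not> r \<le> 1"
    then have r: "0 < r" "Suc 0 < r" "Suc 0 \<le> r" "0 \<le> r" "Suc (Suc 0) \<le> r" by auto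
    have sub: "C 0 \<subset> C (Suc 0)" "C (Suc 0) \<subset> C (Suc (Suc 0))" using C(3) r(1,2) by simp_all
    have "C (Suc (Suc 0)) \<subseteq> carrier torus"
      using closedin_subset[OF C(1)[OF r(5)]] unfolding top .
    then have "C (Suc 0) \<noteq> carrier torus" using sub by blast
    then obtain v where "C (Suc 0) = {v}"
      using torus_irreducible_closed[OF C(1,2)[OF r(3)]] by metis
    then have "C 0 \<subseteq> {v}" "C 0 \<noteq> {v}" using sub(1) by simp_all
    then have "C 0 = {}" using subset_singletonD by metis
    then show False using C(2)[OF r(4)] unfolding irreducible_in_def by simp
  qed
  have chain1: "?chain 1 (\<lambda>i. if i = 0 then {split_vec2 1 1} else carrier torus)"
  proof -
    have 1: "split_vec2 1 1 \<in> carrier torus" by simp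
    have "closedin ?T {split_vec2 1 1}"
      using closed_point[of "split_vec2 1 1" 2] 1 closedin_subtopology[of "zariski UNIV 2" "carrier torus" "{split_vec2 1 1}"]
      by auto
    moreover have "irreducible_in ?T {split_vec2 1 1}"
      unfolding irreducible_in_def top using 1 by simp
    moreover have "closedin ?T (carrier torus)"
      using closedin_topspace[of ?T] unfolding top .
    moreover have "irreducible_in ?T (carrier torus)"
      unfolding irreducible_in_def top
    proof (intro conjI allI impI)
      show "carrier torus \<noteq> {}" using 1 by blast
      fix A B assume "closedin ?T A \<and> closedin ?T B \<and> carrier torus \<subseteq> A \<union> B"
      then obtain A' B' where "closedin (zariski UNIV 2) A'" "closedin (zariski UNIV 2) B'"
         "A = A' \<inter> carrier torus" "B = B' \<inter> carrier torus" "carrier torus \<subseteq> A \<union> B"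
        unfolding closedin_subtopology by blast
      then show "carrier torus \<subseteq> A \<or> carrier torus \<subseteq> B"
        using torus_not_union[of A' B'] by blast
    qed simp
    moreover have "{split_vec2 1 1} \<subset> carrier torus"
      using 1 infinite_torus by (intro psubsetI, simp) (metis finite.emptyI finite.insertI)
    ultimately show ?thesis by simp
  qed
  have "Sup {enat r |r. \<exists>C. ?chain r C} = enat 1"
  proof (rule antisym)
    show "Sup {enat r |r. \<exists>C. ?chain r C} \<le> enat 1"
    proof (rule Sup_least)
      fix x assume "x \<in> {enat r |r. \<exists>C. ?chain r C}"
      then obtain r where r: "x = enat r \<and> (\<exists>C. ?chain r C)"
        by (elim CollectE exE) (rule that)
      then obtain C where "?chain r C" by (elim conjE exE) (rule that, rule conjI)
      then have "r \<le> 1" by (rule le1)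
      then show "x \<le> enat 1" using conjunct1[OF r] by simp
    qed
    show "enat 1 \<le> Sup {enat r |r. \<exists>C. ?chain r C}"
      by (rule Sup_upper, rule CollectI, rule exI[of _ 1], rule conjI[OF refl], rule exI, rule chain1)
  qed
  then show ?thesis unfolding variety_dim_def krull_dim_def one_enat_def by simp
qed

text \<open>
  Translation by \<open>g\<close> multiplies the coordinate function \<open>l\<close> by its value at \<open>g\<close>; a unipotent operator
  has only the eigenvalue 1.
\<close>

lemma unipotent_in_torus:
  assumes "unipotent_element 2 torus g"
  shows "g = split_vec2 1 1"
proof -
  have g: "g \<in> carrier torus" using assms unfolding unipotent_element_def by blast
  let ?f = "\<lambda>x :: 'k alg_closure vec. x $ 0 + s * x $ 1"
  have "?f \<in> polyfun UNIV 2"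
    by (intro polyfun.add polyfun.mult polyfun.const polyfun.coord) simp_all
  then obtain N where N: "\<And>x. x \<in> carrier torus \<Longrightarrow>
      ((\<lambda>h y. h (y \<otimes>\<^bsub>torus\<^esub> g) - h y) ^^ N) ?f x = 0"
    using assms unfolding unipotent_element_def by blast
  have "((\<lambda>h y. h (y \<otimes>\<^bsub>torus\<^esub> g) - h y) ^^ n) ?f x = (split_pos g 0 - 1) ^ n * split_pos x 0" for n x
  proof (induction n arbitrary: x)
    case (Suc n)
    then show ?case by (simp add: algebra_simps)
  qed (simp add: split_pos_def)
  from N[of "split_vec2 1 1", unfolded this] have "split_pos g 0 = 1" by simp
  moreover from this g have "split_neg g 0 = 1" by simp
  ultimately show ?thesis using g split_vec2_of_coords[of g] by simp
qed

lemma torus_reductive: "reductive 2 torus"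
proof -
  interpret comm_group torus by (rule comm_group_torus)
  have normal: "{\<one>\<^bsub>torus\<^esub>} \<lhd> torus"
    by (intro subgroup_imp_normal triv_subgroup)
  have "unipotent_element 2 torus \<one>\<^bsub>torus\<^esub>"
    unfolding unipotent_element_def
  proof (intro conjI ballI)
    fix f :: "'k alg_closure vec \<Rightarrow> 'k alg_closure"
    show "\<exists>N. \<forall>x\<in>carrier torus. ((\<lambda>h y. h (y \<otimes>\<^bsub>torus\<^esub> \<one>\<^bsub>torus\<^esub>) - h y) ^^ N) f x = 0"
    proof (rule exI[of _ "Suc 0"], rule ballI)
      fix x assume x: "x \<in> carrier torus"
      show "((\<lambda>h y. h (y \<otimes>\<^bsub>torus\<^esub> \<one>\<^bsub>torus\<^esub>) - h y) ^^ Suc 0) f x = 0"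
        unfolding funpow.simps comp_def id_def r_one[OF x] by (rule diff_self)
    qed
  qed (rule one_closed)
  then have unipotent: "\<forall>u\<in>{\<one>\<^bsub>torus\<^esub>}. unipotent_element 2 torus u"
    by blast
  have one: "\<one>\<^bsub>torus\<^esub> \<in> carrier_vec 2"
    using one_closed torus_subset by blast
  then have "connectedin (zariski UNIV 2) {\<one>\<^bsub>torus\<^esub>}"
    unfolding connectedin_sing topspace_zariski_UNIV .
  then have "{\<one>\<^bsub>torus\<^esub>} \<subseteq> unipotent_radical 2 torus"
    unfolding unipotent_radical_def
    by (intro Union_upper CollectI conjI normal unipotent closed_point[OF one])
  moreover have "unipotent_radical 2 torus \<subseteq> {\<one>\<^bsub>torus\<^esub>}"
  proof (rule subsetI)
    fix g assume "g \<in> unipotent_radical 2 torus"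
    then have "unipotent_element 2 torus g"
      unfolding unipotent_radical_def by (elim UnionE CollectE conjE) (rule bspec)
    then have "g = \<one>\<^bsub>torus\<^esub>" unfolding torus_simps(3) by (rule unipotent_in_torus)
    then show "g \<in> {\<one>\<^bsub>torus\<^esub>}" by (rule ssubst) (rule singletonI)
  qed
  ultimately show ?thesis unfolding reductive_def by (rule subset_antisym[rotated])
qed

section \<open>The action on affine four-space\<close>

definition torus_act :: "'k alg_closure vec \<Rightarrow> 'k alg_closure vec \<Rightarrow> 'k alg_closure vec" where
  "torus_act g = (\<lambda>v \<in> carrier_vec 4. split_vec4 ((split_pos g 0)\<^sup>2 * split_pos v 0) ((split_neg g 0)\<^sup>2 * split_neg v 0)
     (fibre_act (split_pos g 0) (split_pos v 0) (split_neg v 0) (split_pos v 2) (split_neg v 2))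
     (fibre_act (split_neg g 0) (split_neg v 0) (split_pos v 0) (split_neg v 2) (split_pos v 2)))"

lemma torus_act_split_vec4:
  "torus_act (split_vec2 l m) (split_vec4 z w p q) = split_vec4 (l\<^sup>2 * z) (m\<^sup>2 * w) (fibre_act l z w p q) (fibre_act m w z q p)"
  unfolding torus_act_def by simp

lemma torus_act_carrier: "v \<in> carrier_vec 4 \<Longrightarrow> torus_act g v \<in> carrier_vec 4"
  unfolding torus_act_def by simp

lemma fibre_act_1 [simp]: "fibre_act 1 z w p q = p"
  unfolding fibre_act_def by simp

lemma torus_act_one: "v \<in> carrier_vec 4 \<Longrightarrow> torus_act (split_vec2 1 1) v = v"
  unfolding torus_act_def by simp

lemma torus_act_mult:
  assumes "h \<in> carrier torus" "v \<in> carrier_vec 4"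
  shows "torus_act (g \<otimes>\<^bsub>torus\<^esub> h) v = torus_act g (torus_act h v)"
proof -
  have lm: "split_pos h 0 * split_neg h 0 = 1" and ml: "split_neg h 0 * split_pos h 0 = 1"
    using assms(1) by (simp_all add: mult.commute)
  show ?thesis
    using assms(2) unfolding torus_act_def
    by (simp add: fibre_act_mult[OF lm] fibre_act_mult[OF ml] power_mult_distrib mult.assoc)
qed

lemma group_action_torus_act: "group_action torus (carrier_vec 4) torus_act"
proof -
  let ?V = "carrier_vec 4 :: 'k alg_closure vec set"
  have bij: "torus_act g \<in> Bij ?V" if g: "g \<in> carrier torus" for g
  proof -
    have g': "inv\<^bsub>torus\<^esub> g \<in> carrier torus"
      using group.inv_closed[OF group_torus g] .
    have inverse: "torus_act g (torus_act (inv\<^bsub>torus\<^esub> g) v) = v" "torus_act (inv\<^bsub>torus\<^esub> g) (torus_act g v) = v"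
      if "v \<in> ?V" for v
      using torus_act_mult[OF g' that, of g] torus_act_mult[OF g that, of "inv\<^bsub>torus\<^esub> g"] torus_act_one[OF that]
        group.r_inv[OF group_torus g] group.l_inv[OF group_torus g] torus_simps(3) by metis+
    have "bij_betw (torus_act g) ?V ?V"
      by (rule bij_betw_byWitness[of _ "torus_act (inv\<^bsub>torus\<^esub> g)"]) (use inverse torus_act_carrier in auto)
    then show ?thesis unfolding Bij_def torus_act_def by simp
  qed
  have "torus_act (g \<otimes>\<^bsub>torus\<^esub> h) = compose ?V (torus_act g) (torus_act h)"
    if "g \<in> carrier torus" "h \<in> carrier torus" for g h
  proof (rule extensionalityI[of _ ?V])
    show "torus_act (g \<otimes>\<^bsub>torus\<^esub> h) \<in> extensional ?V" unfolding torus_act_def by (rule restrict_extensional)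
    fix v assume "v \<in> ?V"
    then show "torus_act (g \<otimes>\<^bsub>torus\<^esub> h) v = compose ?V (torus_act g) (torus_act h) v"
      using torus_act_mult[OF that(2)] by (simp only: compose_eq)
  qed (rule compose_extensional)
  then have "torus_act \<in> hom torus (BijGroup ?V)"
    using bij unfolding hom_def BijGroup_def by (auto simp del: torus_simps)
  then show ?thesis
    unfolding group_action_def group_hom_def group_hom_axioms_def
    using group_torus group_BijGroup by blast
qed

lemma conjugate_fibre_act:
  assumes "conjugate n l m" "conjugate n z w" "conjugate n p q"
  shows "conjugate n (\<lambda>x. fibre_act (l x) (z x) (w x) (p x) (q x)) (\<lambda>x. fibre_act (m x) (w x) (z x) (q x) (p x))"
  unfolding fibre_act_def ucoord_def
  by (intro conjugate_add conjugate_mult conjugate_diff conjugate_power assms conjugate_sym[OF assms(1)]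
      conjugate_sym[OF assms(2)] conjugate_sym[OF assms(3)])

lemma algebraic_action_torus_act: "algebraic_action ground_field 2 torus 4 torus_act"
  unfolding algebraic_action_def
proof (intro conjI group_action_torus_act)
  let ?l = "\<lambda>x :: 'k alg_closure vec. x $ 0 + s * x $ 1" and ?m = "\<lambda>x. x $ 0 - s * x $ 1"
  let ?z = "\<lambda>x :: 'k alg_closure vec. x $ 2 + s * x $ 3" and ?w = "\<lambda>x. x $ 2 - s * x $ 3"
  let ?p = "\<lambda>x :: 'k alg_closure vec. x $ 4 + s * x $ 5" and ?q = "\<lambda>x. x $ 4 - s * x $ 5"
  note coords = conjugate_coords[of 0 "2 + 4" 1] conjugate_coords[of 2 "2 + 4" 3] conjugate_coords[of 4 "2 + 4" 5]
  show "morphism_over ground_field (2 + 4) (vec_prod (carrier torus) (carrier_vec 4)) 4 (carrier_vec 4)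
      (\<lambda>x. torus_act (vec_first x 2) (vec_last x 4))"
  proof (rule morphism_over_split_vec4)
    show "conjugate (2 + 4) (\<lambda>x. (?l x)\<^sup>2 * ?z x) (\<lambda>x. (?m x)\<^sup>2 * ?w x)"
      by (intro conjugate_mult conjugate_power coords) simp_all
    show "conjugate (2 + 4) (\<lambda>x. fibre_act (?l x) (?z x) (?w x) (?p x) (?q x))
        (\<lambda>x. fibre_act (?m x) (?w x) (?z x) (?q x) (?p x))"
      by (intro conjugate_fibre_act coords) simp_all
    fix x assume "x \<in> vec_prod (carrier torus) (carrier_vec 4)"
    then have x: "x \<in> carrier_vec (2 + 4)" "vec_last x 4 \<in> carrier_vec 4"
      using vec_prod_parts[OF _ torus_subset order_refl] by blast+
    have last: "vec_last x 4 $ 0 = x $ 2" "vec_last x 4 $ Suc 0 = x $ 3" "vec_last x 4 $ 2 = x $ 4"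
        "vec_last x 4 $ Suc 2 = x $ 5"
      using vec_last_index[OF x(1), of 0] vec_last_index[OF x(1), of 1] vec_last_index[OF x(1), of 2]
        vec_last_index[OF x(1), of 3] by simp_all
    have first: "vec_first x 2 $ 0 = x $ 0" "vec_first x 2 $ Suc 0 = x $ 1"
      by (simp_all add: vec_first_index)
    show "torus_act (vec_first x 2) (vec_last x 4) = split_vec4 ((?l x)\<^sup>2 * ?z x) ((?m x)\<^sup>2 * ?w x)
        (fibre_act (?l x) (?z x) (?w x) (?p x) (?q x)) (fibre_act (?m x) (?w x) (?z x) (?q x) (?p x))"
      unfolding torus_act_def restrict_apply'[OF x(2)] split_pos_def split_neg_def first last ..
    show "torus_act (vec_first x 2) (vec_last x 4) \<in> carrier_vec 4"
      by (rule torus_act_carrier[OF x(2)])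
  qed
qed

section \<open>The obstruction to linearization\<close>

lemma all_less_four: "(\<forall>i<4. P i) \<longleftrightarrow> P 0 \<and> P (Suc 0) \<and> P 2 \<and> P (Suc 2)" for P :: "nat \<Rightarrow> bool"
  by (auto simp: numeral_eq_Suc less_Suc_eq)

lemma sum_four: "(\<Sum>i<4. f i) = f 0 + f (Suc 0) + f 2 + f (Suc 2)" for f :: "nat \<Rightarrow> 'b::comm_monoid_add"
  by (simp add: numeral_eq_Suc add.assoc)

text \<open>
  For \<open>c = 1\<close> the polynomial is even and its odd coefficients vanish; for \<open>c = - 1\<close> it is odd.
\<close>

lemma parity_coeff:
  fixes P :: "'b::field_char_0 poly"
  assumes "\<And>x. poly P (- x) = c * poly P x"
  shows "(- 1) ^ n * coeff P n = c * coeff P n"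
proof -
  have "pcompose P [:0, - 1:] = smult c P"
    by (rule poly_eq_of_agree[of 0]) (simp add: poly_pcompose assms)
  then show ?thesis
    by (metis coeff_pcompose_linear coeff_smult)
qed

lemma fibre_act_scale: "fibre_act l z w (e * p) (e * q) = e * fibre_act l z w p q"
  unfolding fibre_act_def ucoord_def by Groebner_Basis.algebra

lemma conjugate_zero_iff:
  assumes "a \<in> ground_field" "b \<in> ground_field"
  shows "a - s * b = 0 \<longleftrightarrow> a + s * b = 0"
proof
  assume "a - s * b = 0"
  then have "a + s * (- b) = 0" by simp
  from independent_1_s[OF assms(1) ground_closed(6)[OF assms(2)] this]
  show "a + s * b = 0" by simp
next
  assume "a + s * b = 0"
  from independent_1_s[OF assms this] show "a - s * b = 0" by simp
qed

text \<open>
  The obstruction. The differential of \<open>\<psi>\<close> along the plane \<open>p = q = 0\<close>, in the directions of the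
  fibres, is an equivariant map from the bundle to the trivial bundle with weights \<open>\<plusminus>5\<close>. It is
  given by a linear form \<open>F\<close> of weight 5 in \<open>(p, q)\<close> and its conjugate \<open>G\<close>, which are linearly
  independent at every point of the plane. On the line \<open>z = w\<close> this forces \<open>F\<close> to be a constant
  multiple of \<open>p\<close>, by \<open>norm_difference_const\<close>. By equivariance \<open>F\<close> is then a constant multiple of
  \<open>u / w\<close> wherever \<open>z * w\<close> does not vanish, which has a pole along \<open>w = 0\<close>.
\<close>

lemma no_equivariant_immersion:
  fixes \<psi> :: "nat \<Rightarrow> 'k alg_closure vec \<Rightarrow> 'k alg_closure"
  assumes poly: "\<And>j. j < 4 \<Longrightarrow> \<psi> j \<in> polyfun ground_field 4"
    and equivariant: "\<And>l m v. l * m = 1 \<Longrightarrow> v \<in> carrier_vec 4 \<Longrightarrow>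
      \<psi> 0 (torus_act (split_vec2 l m) v) + s * \<psi> 1 (torus_act (split_vec2 l m) v) = l\<^sup>2 * (\<psi> 0 v + s * \<psi> 1 v) \<and>
      \<psi> 0 (torus_act (split_vec2 l m) v) - s * \<psi> 1 (torus_act (split_vec2 l m) v) = m\<^sup>2 * (\<psi> 0 v - s * \<psi> 1 v) \<and>
      \<psi> 2 (torus_act (split_vec2 l m) v) + s * \<psi> 3 (torus_act (split_vec2 l m) v) = l ^ 5 * (\<psi> 2 v + s * \<psi> 3 v) \<and>
      \<psi> 2 (torus_act (split_vec2 l m) v) - s * \<psi> 3 (torus_act (split_vec2 l m) v) = m ^ 5 * (\<psi> 2 v - s * \<psi> 3 v)"
    and immersion: "\<And>c a b. vjet 4 c a b \<Longrightarrow> (\<And>e. c e \<in> carrier_vec 4) \<Longrightarrow> a \<in> carrier_vec 4 \<Longrightarrow> b \<in> carrier_vec 4 \<Longrightarrow>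
      (\<And>j. j < 4 \<Longrightarrow> jet (\<lambda>e. \<psi> j (c e)) (\<psi> j a) 0) \<Longrightarrow> b = 0\<^sub>v 4"
  shows False
proof -
  obtain D where D: "\<And>i j. j < 4 \<Longrightarrow> i < 4 \<Longrightarrow> D j i \<in> polyfun ground_field 4"
     "\<And>j. j < 4 \<Longrightarrow> is_gradient 4 (\<psi> j) (D j)"
    using polyfun_gradients[of 4 \<psi> ground_field 4] poly ground_closed(1,2) by metis
  \<comment> \<open>The derivative of \<open>\<psi> j\<close> at \<open>(z, w, 0, 0)\<close> in the direction \<open>(0, 0, p, q)\<close>.\<close>
  define T where "T j z w p q = D j 2 (split_vec4 z w 0 0) * ((p + q) / 2) + D j 3 (split_vec4 z w 0 0) * ((p - q) / (2 * s))"
    for j z w p q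
  have curve: "vjet 4 (\<lambda>e. split_vec4 z w (e * p) (e * q)) (split_vec4 z w 0 0) (split_vec4 0 0 p q)" for z w p q
    unfolding vjet_def all_less_four split_vec4_index
    using jet_affine[of 0 "(p + q) / 2"] jet_affine[of 0 "(p - q) / (2 * s)"]
    by (simp add: jet_const distrib_left[symmetric] right_diff_distrib[symmetric])
  have jet_T: "jet (\<lambda>e. \<psi> j (split_vec4 z w (e * p) (e * q))) (\<psi> j (split_vec4 z w 0 0)) (T j z w p q)"
    if "j < 4" for j z w p q
  proof -
    have "jet (\<lambda>e. \<psi> j (split_vec4 z w (e * p) (e * q))) (\<psi> j (split_vec4 z w 0 0)) (\<Sum>i<4. D j i (split_vec4 z w 0 0) * split_vec4 0 0 p q $ i)"
      using D(2)[OF that] curve unfolding is_gradient_def by blast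
    also have "(\<Sum>i<4. D j i (split_vec4 z w 0 0) * split_vec4 0 0 p q $ i) = T j z w p q"
      unfolding sum_four split_vec4_index T_def by simp
    finally show ?thesis .
  qed
  have jet_comb: "jet (\<lambda>e. \<psi> i (split_vec4 z w (e * p) (e * q)) + t * \<psi> j (split_vec4 z w (e * p) (e * q)))
      (\<psi> i (split_vec4 z w 0 0) + t * \<psi> j (split_vec4 z w 0 0)) (T i z w p q + t * T j z w p q)"
    if "i < 4" "j < 4" for i j t z w p q
    using that by (intro jet_add jet_cmult jet_T)
  have T_equivariant: "T i (l\<^sup>2 * z) (m\<^sup>2 * w) (fibre_act l z w p q) (fibre_act m w z q p) +
        t * T j (l\<^sup>2 * z) (m\<^sup>2 * w) (fibre_act l z w p q) (fibre_act m w z q p) = k * (T i z w p q + t * T j z w p q)"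
    if ij: "i < 4" "j < 4"
      and eq: "\<And>v. v \<in> carrier_vec 4 \<Longrightarrow> \<psi> i (torus_act (split_vec2 l m) v) + t * \<psi> j (torus_act (split_vec2 l m) v) = k * (\<psi> i v + t * \<psi> j v)"
    for i j l m t k z w p q
  proof -
    have "torus_act (split_vec2 l m) (split_vec4 z w (e * p) (e * q)) =
        split_vec4 (l\<^sup>2 * z) (m\<^sup>2 * w) (e * fibre_act l z w p q) (e * fibre_act m w z q p)" for e
      unfolding torus_act_split_vec4 fibre_act_scale ..
    then have "(\<lambda>e. \<psi> i (split_vec4 (l\<^sup>2 * z) (m\<^sup>2 * w) (e * fibre_act l z w p q) (e * fibre_act m w z q p)) +
        t * \<psi> j (split_vec4 (l\<^sup>2 * z) (m\<^sup>2 * w) (e * fibre_act l z w p q) (e * fibre_act m w z q p))) =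
        (\<lambda>e. k * (\<psi> i (split_vec4 z w (e * p) (e * q)) + t * \<psi> j (split_vec4 z w (e * p) (e * q))))"
      using eq[OF split_vec4_carrier] by metis
    from jet_comb[OF ij, of "l\<^sup>2 * z" "m\<^sup>2 * w" "fibre_act l z w p q" "fibre_act m w z q p" t, unfolded this]
    show ?thesis by (rule jet_unique(2)[OF _ jet_cmult[OF jet_comb[OF ij]]])
  qed
  \<comment> \<open>The element \<open>-1\<close> of the torus negates the fibres, but it fixes the base and acts trivially in
    the weights \<open>\<plusminus>2\<close>. So the components of these weights have derivative 0 along the fibres.\<close>
  have base0: "T 0 z w p q = 0" "T 1 z w p q = 0" for z w p q
  proof -
    have f: "fibre_act (- 1) z w p q = - p" for z w p q :: "'k alg_closure"
      unfolding fibre_act_def by simp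
    have T_minus: "T j z w (- p) (- q) = - T j z w p q" for j
      unfolding T_def by (simp add: field_simps)
    have "2 * (T 0 z w p q + s * T 1 z w p q) = 0"
      using T_equivariant[of 0 1 "- 1" "- 1" s 1 z w p q] equivariant[of "- 1" "- 1"]
      by (simp add: f T_minus algebra_simps)
    then have "T 0 z w p q + s * T 1 z w p q = 0"
      by (metis mult_eq_0_iff zero_neq_numeral)
    moreover have "T 0 z w p q + (- s) * T 1 z w p q = 0"
      using T_equivariant[of 0 1 "- 1" "- 1" "- s" 1 z w p q] equivariant[of "- 1" "- 1"]
      by (simp add: f T_minus)
    ultimately show "T 0 z w p q = 0" "T 1 z w p q = 0" by simp_all
  qed
  define F where "F z w p q = T 2 z w p q + s * T 3 z w p q" for z w p q
  define G where "G z w p q = T 2 z w p q - s * T 3 z w p q" for z w p q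
  have F_equivariant: "F (l\<^sup>2 * z) (m\<^sup>2 * w) (fibre_act l z w p q) (fibre_act m w z q p) = l ^ 5 * F z w p q"
    if "l * m = 1" for l m z w p q
    unfolding F_def by (rule T_equivariant) (use equivariant[OF that] in simp_all)
  have FG_zero: "p = 0 \<and> q = 0" if "F z w p q = 0" "G z w p q = 0" for z w p q
  proof -
    have "T 2 z w p q = 0" "T 3 z w p q = 0"
      using that unfolding F_def G_def by simp_all
    then have "\<forall>j<4. T j z w p q = 0"
      unfolding all_less_four using base0[of z w p q] by (simp add: numeral_3_eq_3[symmetric])
    then have "split_vec4 0 0 p q = 0\<^sub>v 4"
      using immersion[OF curve[of z w p q]] jet_T by (metis split_vec4_carrier)
    then show ?thesis
      using split_vec4_coords(3,4)[of 0 0 p q] by (simp add: split_pos_def split_neg_def)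
  qed
  have "\<exists>P. (\<forall>n. coeff P n \<in> ground_field) \<and> (\<forall>x. D j i (split_vec4 x x 0 0) = poly P x)" if "j < 4" "i < 4" for j i
  proof (rule polyfun_on_poly_curve[OF D(1)[OF that] _ ground_closed(1,4,5)])
    have *: "\<exists>P. (\<forall>n. coeff P n \<in> (ground_field :: 'k alg_closure set)) \<and> (\<forall>x. x = poly P x)"
       "\<exists>P. (\<forall>n. coeff P n \<in> (ground_field :: 'k alg_closure set)) \<and> (\<forall>x. 0 = poly P x)"
      by (rule exI[of _ "[:0, 1:]"], use ground_closed(1,2) in \<open>simp add: coeff_pCons split: nat.split\<close>)
         (rule exI[of _ 0], use ground_closed(1) in simp)
    show "\<forall>i<4. \<exists>P. (\<forall>n. coeff P n \<in> ground_field) \<and> (\<forall>x. split_vec4 x x 0 0 $ i = poly P x)"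
      unfolding all_less_four split_vec4_index using * by simp
  qed
  then obtain a where a: "\<And>j i n. j < 4 \<Longrightarrow> i < 4 \<Longrightarrow> coeff (a j i) n \<in> ground_field"
     "\<And>j i x. j < 4 \<Longrightarrow> i < 4 \<Longrightarrow> D j i (split_vec4 x x 0 0) = poly (a j i) x"
    by metis
  define r where "r = 1 / to_ac \<alpha>"
  have r: "r \<in> ground_field"
    unfolding r_def by (rule ground_closed(7)[OF ground_closed(2) ground_alpha(1)])
  have ssr: "s * s * r = 1"
    unfolding r_def ground_alpha(2)[symmetric] by simp
  have lt: "(2::nat) < 4" "(3::nat) < 4" by simp_all
  have T_slice: "T j x x p q = poly (a j 2) x * (1/2 * (p + q)) + poly (a j 3) x * (1/2 * (s * r * (p - q)))"
    if "j < 4" for j x p q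
  proof -
    have "(p - q) / (2 * s) = (s * s * r) * (p - q) / (2 * s)" unfolding ssr by simp
    also have "\<dots> = 1/2 * (s * r * (p - q))" by simp
    finally have eq: "(p - q) / (2 * s) = 1/2 * (s * r * (p - q))" .
    show ?thesis unfolding T_def a(2)[OF that lt(1)] a(2)[OF that lt(2)] eq by simp
  qed
  define A1 where "A1 = smult (1/2) (a 2 2 + a 3 3)"
  define A2 where "A2 = smult (1/2) (a 3 2 + smult r (a 2 3))"
  define B1 where "B1 = smult (1/2) (a 2 2 - a 3 3)"
  define B2 where "B2 = smult (1/2) (a 3 2 - smult r (a 2 3))"
  note AB_defs = A1_def A2_def B1_def B2_def
  define A where "A = A1 + smult s A2"
  define A' where "A' = A1 - smult s A2"
  define B where "B = B1 + smult s B2"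
  define B' where "B' = B1 - smult s B2"
  have F_slice: "F x x p q = poly A x * p + poly B x * q" for x p q
  proof -
    have "a22 * (h * (p + q)) + a23 * (h * (s * r * (p - q))) + s * (a32 * (h * (p + q)) + a33 * (h * (s * r * (p - q)))) =
      (h * (a22 + a33) + s * (h * (a32 + r * a23))) * p + (h * (a22 - a33) + s * (h * (a32 - r * a23))) * q"
      for a22 a23 a32 a33 h using ssr by Groebner_Basis.algebra
    then show ?thesis
      unfolding F_def A_def B_def AB_defs T_slice[OF lt(1)] T_slice[OF lt(2)] poly_add poly_diff poly_smult .
  qed
  have G_slice: "G x x p q = poly B' x * p + poly A' x * q" for x p q
  proof -
    have "a22 * (h * (p + q)) + a23 * (h * (s * r * (p - q))) - s * (a32 * (h * (p + q)) + a33 * (h * (s * r * (p - q)))) =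
      (h * (a22 - a33) - s * (h * (a32 - r * a23))) * p + (h * (a22 + a33) - s * (h * (a32 + r * a23))) * q"
      for a22 a23 a32 a33 h using ssr by Groebner_Basis.algebra
    then show ?thesis
      unfolding G_def A'_def B'_def AB_defs T_slice[OF lt(1)] T_slice[OF lt(2)] poly_add poly_diff poly_smult .
  qed
  have half: "1/2 \<in> (ground_field :: 'k alg_closure set)"
    by (rule ground_closed(7)[OF ground_closed(2) ground_closed(3)])
  have minus: "x - y \<in> (ground_field :: 'k alg_closure set)" if "x \<in> ground_field" "y \<in> ground_field" for x y
    using ground_closed(4)[OF that(1) ground_closed(6)[OF that(2)]] by simp
  have AB_ground: "coeff A1 n \<in> ground_field" "coeff A2 n \<in> ground_field"
    "coeff B1 n \<in> ground_field" "coeff B2 n \<in> ground_field" for n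
  proof -
    have a_ground: "coeff (a 2 2) n \<in> ground_field" "coeff (a 3 3) n \<in> ground_field"
        "coeff (a 3 2) n \<in> ground_field" "r * coeff (a 2 3) n \<in> ground_field"
      using a(1) ground_closed(5)[OF r a(1)] by simp_all
    show "coeff A1 n \<in> ground_field" "coeff A2 n \<in> ground_field"
        "coeff B1 n \<in> ground_field" "coeff B2 n \<in> ground_field"
      unfolding AB_defs coeff_smult coeff_add coeff_diff
      by (rule ground_closed(5)[OF half ground_closed(4)[OF a_ground(1,2)]],
          rule ground_closed(5)[OF half ground_closed(4)[OF a_ground(3,4)]],
          rule ground_closed(5)[OF half minus[OF a_ground(1,2)]],
          rule ground_closed(5)[OF half minus[OF a_ground(3,4)]])
  qed
  have conj: "coeff A' n = 0 \<longleftrightarrow> coeff A n = 0" "coeff B' n = 0 \<longleftrightarrow> coeff B n = 0" for n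
    unfolding A_def A'_def B_def B'_def coeff_add coeff_diff coeff_smult
    by (rule conjugate_zero_iff[OF AB_ground(1,2)], rule conjugate_zero_iff[OF AB_ground(3,4)])
  \<comment> \<open>The element with \<open>l\<^sup>2 = -1\<close> maps the line \<open>z = w\<close> to itself by \<open>x \<mapsto> -x\<close>, and it scales \<open>p\<close> and
    \<open>q\<close> there by \<open>l\<close> and \<open>-l\<close>. This determines the parities of \<open>A\<close> and \<open>B\<close>.\<close>
  obtain \<iota> :: "'k alg_closure" where "\<iota> ^ 2 = - 1"
    using nth_root_exists[of 2 "- 1 :: 'k alg_closure"] by (metis zero_less_numeral)
  then have ii: "\<iota> * \<iota> = - 1" by (simp add: power2_eq_square)
  have i: "\<iota> * - \<iota> = 1" "\<iota>\<^sup>2 = - 1" "\<iota> ^ 5 = \<iota>" "(- \<iota>)\<^sup>2 = - 1" "\<iota> \<noteq> 0"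
    using ii by (auto simp: power2_eq_square power_numeral_odd power_numeral_even)
  have i': "\<iota> ^ 3 = - \<iota>" "\<iota> ^ 7 = - \<iota>"
    using ii by (simp_all add: power_numeral_odd power_numeral_even)
  have diag: "ucoord x x p q = x * p" for x p q :: "'k alg_closure"
    unfolding ucoord_def by simp
  have fi: "fibre_act \<iota> x x p q = \<iota> * p" "fibre_act (- \<iota>) x x p q = - \<iota> * p" for x p q
    unfolding fibre_act_def diag by (simp_all add: i(3) i' algebra_simps)
  have parity: "poly A (- x) = poly A x" "poly B (- x) = - poly B x" for x
  proof -
    have "F (- x) (- x) (\<iota> * p) (- \<iota> * q) = \<iota> * F x x p q" for p q
      using F_equivariant[OF i(1), of x x p q] unfolding fi i(2-4) by simp
    from this[of 1 0] this[of 0 1]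
    have "poly A (- x) = poly A x" and B: "\<iota> * poly B x = - (poly B (- x) * \<iota>)"
      unfolding F_slice using i(5) by simp_all
    moreover have "\<iota> * (poly B (- x) + poly B x) = 0"
      unfolding distrib_left B by (simp add: mult.commute)
    ultimately have "poly A (- x) = poly A x" "\<iota> * (poly B (- x) + poly B x) = 0"
      by simp_all
    then show "poly A (- x) = poly A x" "poly B (- x) = - poly B x"
      using i(5) by (simp_all add: eq_neg_iff_add_eq_0)
  qed
  have even: "coeff A n = 0" if "odd n" for n
    using parity_coeff[of A 1 n] parity(1) that by simp
  have odd: "coeff B n = 0" if "even n" for n
    using parity_coeff[of B "- 1" n] parity(2) that by simp
  \<comment> \<open>A common kernel vector of \<open>F\<close> and \<open>G\<close> would contradict the injectivity of the differential.\<close>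
  have no_root: "poly (A * A' - B * B') x \<noteq> 0" for x
  proof
    assume 0: "poly (A * A' - B * B') x = 0"
    have "\<exists>p q. (p \<noteq> 0 \<or> q \<noteq> 0) \<and> F x x p q = 0 \<and> G x x p q = 0"
    proof (cases "poly A x = 0 \<and> poly B x = 0")
      case False
      then show ?thesis
        using 0 unfolding F_slice G_slice
        by (intro exI[of _ "- poly B x"] exI[of _ "poly A x"]) (auto simp: algebra_simps)
    next
      case AB: True
      show ?thesis
      proof (cases "poly A' x = 0 \<and> poly B' x = 0")
        case False
        then show ?thesis
          using AB unfolding F_slice G_slice
          by (intro exI[of _ "poly A' x"] exI[of _ "- poly B' x"]) (auto simp: algebra_simps)
      next
        case True
        then show ?thesis
          using AB unfolding F_slice G_slice by (intro exI[of _ 1]) auto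
      qed
    qed
    then show False using FG_zero by blast
  qed
  then have "degree (A * A' - B * B') = 0"
    using alg_closed_imp_poly_has_root by blast
  note const = norm_difference_const[OF conj even odd this]
  then have B: "B = 0" by simp
  obtain f0 where f0: "A = [:f0:]"
    using const(1) by (rule degree_eq_zeroE)
  have "f0 \<noteq> 0"
    using no_root[of 0] f0 B by auto
  have "\<exists>P. (\<forall>n. coeff P n \<in> UNIV) \<and> (\<forall>w. D j i (split_vec4 1 w 0 0) = poly P w)" if "j < 4" "i < 4" for j i
  proof (rule polyfun_on_poly_curve)
    show "D j i \<in> polyfun UNIV 4"
      using D(1)[OF that] by induction (auto intro: polyfun.intros)
    have "\<exists>P. \<forall>w :: 'k alg_closure. (1 + w) / 2 = poly P w"
      by (rule exI[of _ "[:1/2, 1/2:]"]) (simp add: field_simps)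
    moreover have "\<exists>P. \<forall>w. (1 - w) / (2 * s) = poly P w"
      by (rule exI[of _ "[:1/(2*s), - (1/(2*s)):]"]) (simp add: diff_divide_distrib)
    moreover have "\<exists>P. \<forall>w :: 'k alg_closure. 0 = poly P w"
      by (rule exI[of _ 0]) simp
    ultimately show "\<forall>i<4. \<exists>P. (\<forall>n. coeff P n \<in> UNIV) \<and> (\<forall>w. split_vec4 1 w 0 0 $ i = poly P w)"
      unfolding all_less_four split_vec4_index by simp
  qed simp_all
  then obtain b where b: "\<And>j i w. j < 4 \<Longrightarrow> i < 4 \<Longrightarrow> D j i (split_vec4 1 w 0 0) = poly (b j i) w"
    by metis
  define R where "R = smult (1/2) (b 2 2 + smult s (b 3 2)) - smult (1 / (2 * s)) (b 2 3 + smult s (b 3 3))"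
  have R: "F 1 w 0 1 = poly R w" for w
    unfolding F_def T_def R_def using b by (simp add: field_simps)
  have "[:f0, - f0:] = [:0, 1:] * R"
  proof (rule poly_eq_of_agree[of 0])
    fix w :: "'k alg_closure" assume "w \<noteq> 0"
    \<comment> \<open>The element \<open>l\<close> moves the point \<open>(1, w)\<close> to the line \<open>z = w\<close>, as \<open>w / l\<^sup>2 = l\<^sup>2\<close>.\<close>
    obtain l where l: "l ^ 4 = w"
      using nth_root_exists[of 4 w] by (metis zero_less_numeral)
    then have "l \<noteq> 0" using \<open>w \<noteq> 0\<close> by auto
    then have lm: "l * (1 / l) = 1" "l\<^sup>2 * 1 = l\<^sup>2" "(1 / l)\<^sup>2 * w = l\<^sup>2"
      unfolding l[symmetric] by (simp_all add: field_simps power2_eq_square numeral_eq_Suc)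
    have "fibre_act l 1 w 0 1 = l * (1 - w)"
      unfolding fibre_act_def ucoord_def l[symmetric] by (simp add: numeral_eq_Suc algebra_simps)
    then have "f0 * (l * (1 - w)) = l ^ 5 * poly R w"
      using F_equivariant[OF lm(1), of 1 w 0 1] unfolding lm(2,3) F_slice f0 B R by simp
    also have "\<dots> = l * (w * poly R w)"
      unfolding l[symmetric] by (simp add: numeral_eq_Suc)
    finally have "l * (f0 * (1 - w)) = l * (w * poly R w)" by (simp only: mult.left_commute)
    then have "f0 * (1 - w) = w * poly R w" using \<open>l \<noteq> 0\<close> by simp
    then show "poly [:f0, - f0:] w = poly ([:0, 1:] * R) w" by (simp add: algebra_simps)
  qed
  then have "coeff [:f0, - f0:] 0 = coeff ([:0, 1:] * R) 0" by (simp only:)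
  then have "f0 = 0" by simp
  then show False using \<open>f0 \<noteq> 0\<close> by simp
qed

section \<open>The action is not linearizable\<close>

lemma polyfun_value_in_field:
  assumes "f \<in> polyfun ground_field n" "\<And>i. i < n \<Longrightarrow> x $ i \<in> (ground_field :: 'k alg_closure set)"
  shows "f x \<in> ground_field"
  using assms(1) by induction (auto intro: assms(2) ground_closed(4,5))

lemma jet_split_pos: "vjet 4 c a b \<Longrightarrow> Suc i < 4 \<Longrightarrow> jet (\<lambda>e. split_pos (c e) i) (split_pos a i) (split_pos b i)"
  unfolding split_pos_def vjet_def by (intro jet_add jet_cmult) simp_all

lemma jet_split_neg: "vjet 4 c a b \<Longrightarrow> Suc i < 4 \<Longrightarrow> jet (\<lambda>e. split_neg (c e) i) (split_neg a i) (split_neg b i)"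
  unfolding split_neg_def vjet_def by (intro jet_diff jet_cmult) simp_all

text \<open>
  At the origin the action is tangent to the linear one with weight 5: all other terms of
  \<open>fibre_act\<close> vanish to second order.
\<close>

lemma jet_fibre_act:
  assumes z: "jet z 0 z'" and w: "jet w 0 w'" and p: "jet p 0 p'" and q: "jet q 0 q'"
  shows "jet (\<lambda>e. fibre_act l (z e) (w e) (p e) (q e)) 0 (l ^ 5 * p')"
proof -
  have u: "jet (\<lambda>e. ucoord (z e) (w e) (p e) (q e)) 0 0"
    if z: "jet z 0 z'" and w: "jet w 0 w'" and p: "jet p 0 p'" and q: "jet q 0 q'" for z w p q z' w' p' q'
    using jet_diff[OF jet_mult[OF w p] jet_mult[OF jet_mult[OF z jet_diff[OF z w]]
      jet_diff[OF jet_mult[OF jet_mult[OF w w] p] jet_mult[OF jet_mult[OF z z] q]]]]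
    unfolding ucoord_def power2_eq_square by simp
  note U = u[OF z w p q] and V = u[OF w z q p]
  show ?thesis
    using jet_add[OF jet_cmult[OF p, of "l ^ 5"] jet_mult[OF z jet_diff[OF jet_add[OF jet_mult[OF jet_cmult[OF z, of "l ^ 7 - l ^ 5"] U]
        jet_mult[OF jet_cmult[OF w, of "l ^ 5 - l ^ 3"] U]] jet_mult[OF jet_cmult[OF z, of "l ^ 5 - l"] V]]]]
    unfolding fibre_act_def by simp
qed

lemma split_zero [simp]: "Suc i < 4 \<Longrightarrow> split_pos (0\<^sub>v 4) i = 0" "Suc i < 4 \<Longrightarrow> split_neg (0\<^sub>v 4) i = 0"
  unfolding split_pos_def split_neg_def by simp_all

lemma jet_torus_act:
  assumes c: "vjet 4 c (0\<^sub>v 4) b" and "\<And>e. c e \<in> carrier_vec 4"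
  shows "jet (\<lambda>e. split_pos (torus_act (split_vec2 l m) (c e)) 0) 0 (l\<^sup>2 * split_pos b 0)"
    "jet (\<lambda>e. split_neg (torus_act (split_vec2 l m) (c e)) 0) 0 (m\<^sup>2 * split_neg b 0)"
    "jet (\<lambda>e. split_pos (torus_act (split_vec2 l m) (c e)) 2) 0 (l ^ 5 * split_pos b 2)"
    "jet (\<lambda>e. split_neg (torus_act (split_vec2 l m) (c e)) 2) 0 (m ^ 5 * split_neg b 2)"
proof -
  have coords: "jet (\<lambda>e. split_pos (c e) 0) 0 (split_pos b 0)" "jet (\<lambda>e. split_neg (c e) 0) 0 (split_neg b 0)"
      "jet (\<lambda>e. split_pos (c e) 2) 0 (split_pos b 2)" "jet (\<lambda>e. split_neg (c e) 2) 0 (split_neg b 2)"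
    using jet_split_pos[OF c, of 0] jet_split_neg[OF c, of 0] jet_split_pos[OF c, of 2] jet_split_neg[OF c, of 2] by simp_all
  have image: "torus_act (split_vec2 l m) (c e) = split_vec4 (l\<^sup>2 * split_pos (c e) 0) (m\<^sup>2 * split_neg (c e) 0)
      (fibre_act l (split_pos (c e) 0) (split_neg (c e) 0) (split_pos (c e) 2) (split_neg (c e) 2))
      (fibre_act m (split_neg (c e) 0) (split_pos (c e) 0) (split_neg (c e) 2) (split_pos (c e) 2))" for e
    unfolding torus_act_def using assms(2) by simp
  show "jet (\<lambda>e. split_pos (torus_act (split_vec2 l m) (c e)) 0) 0 (l\<^sup>2 * split_pos b 0)"
    "jet (\<lambda>e. split_neg (torus_act (split_vec2 l m) (c e)) 0) 0 (m\<^sup>2 * split_neg b 0)"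
    unfolding image split_vec4_coords using jet_cmult[OF coords(1), of "l\<^sup>2"] jet_cmult[OF coords(2), of "m\<^sup>2"] by simp_all
  show "jet (\<lambda>e. split_pos (torus_act (split_vec2 l m) (c e)) 2) 0 (l ^ 5 * split_pos b 2)"
    "jet (\<lambda>e. split_neg (torus_act (split_vec2 l m) (c e)) 2) 0 (m ^ 5 * split_neg b 2)"
    unfolding image split_vec4_coords by (rule jet_fibre_act[OF coords], rule jet_fibre_act[OF coords(2,1,4,3)])
qed

lemma torus_act_zero: "torus_act g (0\<^sub>v 4) = 0\<^sub>v 4"
proof -
  have "split_vec4 0 0 0 0 = 0\<^sub>v 4"
    using split_vec4_of_coords[of "0\<^sub>v 4"] by simp
  then show ?thesis unfolding torus_act_def by (simp add: fibre_act_def ucoord_def)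
qed

text \<open>
  Let \<open>\<phi>\<close> linearize the action, with inverse \<open>\<chi>\<close>, and let \<open>L\<close> be the derivative of \<open>\<chi>\<close> at the image
  of the origin. Differentiating \<open>\<chi> (\<rho> y) = g (\<chi> y)\<close>, where \<open>\<rho>\<close> is the linear map by which \<open>g\<close> acts after the
  linearization, shows that \<open>L\<close> carries \<open>\<rho>\<close> to the tangent action of \<open>g\<close> at the origin. So \<open>L \<circ> \<phi>\<close> is
  equivariant for the weights 2, -2, 5, -5. Its differential is injective everywhere, since \<open>\<phi>\<close> and
  \<open>L\<close> are invertible, and it is defined over the ground field because \<open>\<phi>\<close> and the origin are.
\<close>

lemma torus_act_not_linearizable: "\<not> linearizable ground_field torus 4 torus_act"
proof
  assume "linearizable ground_field torus 4 torus_act"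
  let ?V = "carrier_vec 4 :: 'k alg_closure vec set"
  obtain \<phi> where \<phi>: "affine_space_automorphism ground_field 4 \<phi>"
    "\<And>g. g \<in> carrier torus \<Longrightarrow> linear_on_vec 4 (\<lambda>v. \<phi> (torus_act g (inv_into ?V \<phi> v)))"
    using \<open>linearizable ground_field torus 4 torus_act\<close> unfolding linearizable_def by blast
  define \<chi> where "\<chi> = inv_into ?V \<phi>"
  have bij: "bij_betw \<phi> ?V ?V" and mor: "morphism_over ground_field 4 ?V 4 ?V \<phi>" "morphism_over ground_field 4 ?V 4 ?V \<chi>"
    using \<phi>(1) unfolding affine_space_automorphism_def \<chi>_def by blast+
  have \<phi>V: "\<phi> v \<in> ?V" and \<chi>V: "\<chi> v \<in> ?V" and \<chi>\<phi>: "\<chi> (\<phi> v) = v" and \<phi>\<chi>: "\<phi> (\<chi> v) = v" if "v \<in> ?V" for v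
    using bij that unfolding \<chi>_def
    by (auto simp: bij_betw_def inv_into_f_f f_inv_into_f intro: inv_into_into)
  obtain f where f: "\<And>i. i < 4 \<Longrightarrow> f i \<in> polyfun ground_field 4" "\<And>v. v \<in> ?V \<Longrightarrow> \<phi> v = vec 4 (\<lambda>i. f i v)"
    using mor(1) unfolding morphism_over_def by metis
  obtain h where h: "\<And>i. i < 4 \<Longrightarrow> h i \<in> polyfun ground_field 4" "\<And>v. v \<in> ?V \<Longrightarrow> \<chi> v = vec 4 (\<lambda>i. h i v)"
    using mor(2) unfolding morphism_over_def by metis
  obtain Df where Df: "\<And>j. j < 4 \<Longrightarrow> is_gradient 4 (f j) (Df j)"
    using polyfun_gradients[of 4 f ground_field 4] f(1) ground_closed(1,2) by metis
  obtain Dh where Dh: "\<And>i j. j < 4 \<Longrightarrow> i < 4 \<Longrightarrow> Dh j i \<in> polyfun ground_field 4"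
      "\<And>j. j < 4 \<Longrightarrow> is_gradient 4 (h j) (Dh j)"
    using polyfun_gradients[of 4 h ground_field 4] h(1) ground_closed(1,2) by metis
  define d\<phi> where "d\<phi> a b = vec 4 (\<lambda>j. \<Sum>i<4. Df j i a * b $ i)" for a b
  define d\<chi> where "d\<chi> a b = vec 4 (\<lambda>j. \<Sum>i<4. Dh j i a * b $ i)" for a b
  have dV: "d\<phi> a b \<in> ?V" "d\<chi> a b \<in> ?V" for a b
    unfolding d\<phi>_def d\<chi>_def by simp_all
  have \<phi>_jet: "vjet 4 (\<lambda>e. \<phi> (c e)) (\<phi> a) (d\<phi> a b)" if "vjet 4 c a b" "\<And>e. c e \<in> ?V" "a \<in> ?V" for c a b
    using vjet_map[OF Df that(1)] that(2,3) by (simp add: f(2) d\<phi>_def)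
  have \<chi>_jet: "vjet 4 (\<lambda>e. \<chi> (c e)) (\<chi> a) (d\<chi> a b)" if "vjet 4 c a b" "\<And>e. c e \<in> ?V" "a \<in> ?V" for c a b
    using vjet_map[OF Dh(2) that(1)] that(2,3) by (simp add: h(2) d\<chi>_def)
  define x0 where "x0 = \<phi> (0\<^sub>v 4)"
  have x0: "x0 \<in> ?V" "\<chi> x0 = 0\<^sub>v 4"
    unfolding x0_def using \<phi>V \<chi>\<phi> by simp_all
  define L where "L = d\<chi> x0"
  have inverse: "d\<phi> (0\<^sub>v 4) (L b) = b" if b: "b \<in> ?V" for b
  proof -
    have line: "vjet 4 (\<lambda>e. x0 + e \<cdot>\<^sub>v b) x0 b" "x0 + e \<cdot>\<^sub>v b \<in> ?V" for e
      using vjet_line x0(1) b by auto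
    from \<phi>_jet[OF \<chi>_jet[OF this x0(1)]]
    have "vjet 4 (\<lambda>e. x0 + e \<cdot>\<^sub>v b) x0 (d\<phi> (0\<^sub>v 4) (L b))"
      using x0 \<chi>V line(2) by (simp add: \<phi>\<chi> L_def x0_def[symmetric])
    then show ?thesis
      using vjet_unique[OF _ line(1) dV(1) b] by blast
  qed
  define \<psi> where "\<psi> j v = (\<Sum>i<4. Dh j i x0 * f i v)" for j v
  have \<psi>_L: "L (\<phi> v) = vec 4 (\<lambda>j. \<psi> j v)" if "v \<in> ?V" for v
    unfolding L_def d\<chi>_def \<psi>_def f(2)[OF that] by simp
  have "Dh j i x0 \<in> ground_field" if "j < 4" "i < 4" for i j
  proof (rule polyfun_value_in_field[OF Dh(1)[OF that]])
    fix i :: nat assume "i < 4"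
    then show "x0 $ i \<in> ground_field"
      unfolding x0_def f(2)[OF zero_carrier_vec]
      using polyfun_value_in_field[OF f(1)] ground_closed(1) by simp
  qed
  then have poly: "\<psi> j \<in> polyfun ground_field 4" if "j < 4" for j
    unfolding \<psi>_def sum_four using that by (intro polyfun.add polyfun.mult polyfun.const f(1)) simp_all
  have equivariant:
    "split_pos (L (\<phi> (torus_act (split_vec2 l m) v))) 0 = l\<^sup>2 * split_pos (L (\<phi> v)) 0 \<and> split_neg (L (\<phi> (torus_act (split_vec2 l m) v))) 0 = m\<^sup>2 * split_neg (L (\<phi> v)) 0 \<and>
     split_pos (L (\<phi> (torus_act (split_vec2 l m) v))) 2 = l ^ 5 * split_pos (L (\<phi> v)) 2 \<and> split_neg (L (\<phi> (torus_act (split_vec2 l m) v))) 2 = m ^ 5 * split_neg (L (\<phi> v)) 2"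
    if lm: "l * m = 1" and v: "v \<in> ?V" for l m v
  proof -
    let ?g = "split_vec2 l m"
    define \<rho> where "\<rho> y = \<phi> (torus_act ?g (\<chi> y))" for y
    have lin: "linear_on_vec 4 \<rho>"
      using \<phi>(2)[OF split_vec2_in_torus[OF lm]] unfolding \<rho>_def \<chi>_def .
    let ?y = "\<phi> v"
    have y: "?y \<in> ?V" "\<rho> ?y = \<phi> (torus_act ?g v)" "\<rho> ?y \<in> ?V"
      using v \<phi>V \<chi>\<phi> torus_act_carrier unfolding \<rho>_def by simp_all
    \<comment> \<open>The origin is a fixed point, so the curve \<open>x0 + e * y\<close> is mapped to \<open>x0 + e * \<rho> y\<close>.\<close>
    have "\<rho> x0 = x0"
      unfolding \<rho>_def x0(2) torus_act_zero by (simp only: x0_def)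
    then have "\<rho> (x0 + e \<cdot>\<^sub>v ?y) = x0 + e \<cdot>\<^sub>v \<rho> ?y" for e
      using lin x0(1) y(1) unfolding linear_on_vec_def by simp
    then have "torus_act ?g (\<chi> (x0 + e \<cdot>\<^sub>v ?y)) = \<chi> (x0 + e \<cdot>\<^sub>v \<rho> ?y)" for e
      using \<chi>\<phi>[OF torus_act_carrier[OF \<chi>V]] x0(1) y(1) unfolding \<rho>_def by (metis add_carrier_vec smult_carrier_vec)
    moreover have "vjet 4 (\<lambda>e. \<chi> (x0 + e \<cdot>\<^sub>v \<rho> ?y)) (0\<^sub>v 4) (L (\<rho> ?y))"
      using \<chi>_jet[OF vjet_line[OF x0(1) y(3)] _ x0(1)] x0 y(3) unfolding L_def by simp
    ultimately have jet: "vjet 4 (\<lambda>e. torus_act ?g (\<chi> (x0 + e \<cdot>\<^sub>v ?y))) (0\<^sub>v 4) (L (\<rho> ?y))"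
      by simp
    have "vjet 4 (\<lambda>e. \<chi> (x0 + e \<cdot>\<^sub>v ?y)) (0\<^sub>v 4) (L ?y)"
      using \<chi>_jet[OF vjet_line[OF x0(1) y(1)] _ x0(1)] x0 y(1) unfolding L_def by simp
    note tangent = jet_torus_act[OF this, of l m]
    have "\<chi> (x0 + e \<cdot>\<^sub>v ?y) \<in> ?V" for e
      using \<chi>V x0(1) y(1) by simp
    note tangent = tangent[OF this]
    show ?thesis
      unfolding y(2)[symmetric]
      using jet_unique(2)[OF jet_split_pos[OF jet] tangent(1)] jet_unique(2)[OF jet_split_neg[OF jet] tangent(2)]
        jet_unique(2)[OF jet_split_pos[OF jet] tangent(3)] jet_unique(2)[OF jet_split_neg[OF jet] tangent(4)] by simp
  qed
  have immersion: "b = 0\<^sub>v 4"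
    if c: "vjet 4 c a b" "\<And>e. c e \<in> ?V" and ab: "a \<in> ?V" "b \<in> ?V"
      and zero: "\<And>j. j < 4 \<Longrightarrow> jet (\<lambda>e. \<psi> j (c e)) (\<psi> j a) 0" for c a b
  proof -
    let ?b = "d\<phi> a b"
    have \<phi>c: "vjet 4 (\<lambda>e. \<phi> (c e)) (\<phi> a) ?b"
      by (rule \<phi>_jet[OF c ab(1)])
    have "L ?b = 0\<^sub>v 4"
    proof (rule eq_vecI)
      fix j assume "j < dim_vec (0\<^sub>v 4 :: 'k alg_closure vec)"
      then have j: "j < 4" by simp
      have "jet (\<lambda>e. \<Sum>i<4. Dh j i x0 * \<phi> (c e) $ i) (\<Sum>i<4. Dh j i x0 * \<phi> a $ i) (\<Sum>i<4. Dh j i x0 * ?b $ i)"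
        using \<phi>c unfolding sum_four vjet_def by (intro jet_add jet_cmult) simp_all
      moreover have "(\<Sum>i<4. Dh j i x0 * \<phi> v $ i) = \<psi> j v" if "v \<in> ?V" for v
        unfolding \<psi>_def f(2)[OF that] by simp
      ultimately have "jet (\<lambda>e. \<psi> j (c e)) (\<psi> j a) (\<Sum>i<4. Dh j i x0 * ?b $ i)"
        using c(2) ab(1) by simp
      from jet_unique(2)[OF this zero[OF j]] show "L ?b $ j = 0\<^sub>v 4 $ j"
        using j unfolding L_def d\<chi>_def by simp
    qed (simp add: L_def d\<chi>_def)
    then have "?b = d\<phi> (0\<^sub>v 4) (0\<^sub>v 4)"
      using inverse[OF dV(1), of a b] by simp
    then have "?b = 0\<^sub>v 4"
      unfolding d\<phi>_def[of "0\<^sub>v 4"] by (auto intro!: eq_vecI)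
    then have "d\<chi> (\<phi> a) ?b = 0\<^sub>v 4"
      unfolding d\<chi>_def by (auto intro!: eq_vecI)
    moreover have "vjet 4 (\<lambda>e. \<chi> (\<phi> (c e))) (\<chi> (\<phi> a)) (d\<chi> (\<phi> a) ?b)"
      using \<chi>_jet[OF \<phi>c] \<phi>V c(2) ab(1) by simp
    ultimately have "vjet 4 c a (0\<^sub>v 4)"
      using \<chi>\<phi> c(2) ab(1) by simp
    then show ?thesis
      using vjet_unique[OF c(1) _ ab(2)] by simp
  qed
  show False
  proof (rule no_equivariant_immersion)
    show "\<psi> j \<in> polyfun ground_field 4" if "j < 4" for j
      using that by (rule poly)
    show "b = 0\<^sub>v 4" if "vjet 4 c a b" "\<And>e. c e \<in> ?V" "a \<in> ?V" "b \<in> ?V"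
        "\<And>j. j < 4 \<Longrightarrow> jet (\<lambda>e. \<psi> j (c e)) (\<psi> j a) 0" for c a b
      using that by (rule immersion)
  next
    fix l m v assume lm: "l * m = (1 :: 'k alg_closure)" and v: "v \<in> ?V"
    have "(1 :: nat) = Suc 0" "(3 :: nat) = Suc 2" by simp_all
    then show "\<psi> 0 (torus_act (split_vec2 l m) v) + s * \<psi> 1 (torus_act (split_vec2 l m) v) = l\<^sup>2 * (\<psi> 0 v + s * \<psi> 1 v) \<and>
      \<psi> 0 (torus_act (split_vec2 l m) v) - s * \<psi> 1 (torus_act (split_vec2 l m) v) = m\<^sup>2 * (\<psi> 0 v - s * \<psi> 1 v) \<and>
      \<psi> 2 (torus_act (split_vec2 l m) v) + s * \<psi> 3 (torus_act (split_vec2 l m) v) = l ^ 5 * (\<psi> 2 v + s * \<psi> 3 v) \<and>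
      \<psi> 2 (torus_act (split_vec2 l m) v) - s * \<psi> 3 (torus_act (split_vec2 l m) v) = m ^ 5 * (\<psi> 2 v - s * \<psi> 3 v)"
      using equivariant[OF lm v] unfolding \<psi>_L[OF v] \<psi>_L[OF torus_act_carrier[OF v]] split_pos_def split_neg_def by simp
  qed
qed

end

section \<open>A non-linearizable action\<close>

theorem corollary1:
  fixes \<alpha> :: "'k::field_char_0"
  assumes "\<alpha> \<noteq> 0" and "\<nexists>\<beta>. \<alpha> = \<beta>\<^sup>2"
  shows "\<exists>(m::nat) (G :: 'k alg_closure vec monoid) \<mu>.
    algebraic_group ground_field m G \<and>
    variety_dim m (carrier G) = 1 \<and>
    comm_group G \<and>
    connectedin (zariski UNIV m) (carrier G) \<and>
    reductive m G \<and>
    algebraic_action ground_field m G 4 \<mu> \<and>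
    \<not> linearizable ground_field G 4 \<mu>"
proof -
  obtain s :: "'k alg_closure" where "s\<^sup>2 = to_ac \<alpha>"
    using nth_root_exists[of 2 "to_ac \<alpha>"] by (metis zero_less_numeral)
  then interpret quadratic_extension \<alpha> s
    using assms(2) by unfold_locales
  show ?thesis
    by (rule exI[of _ 2], rule exI[of _ torus], rule exI[of _ torus_act],
        intro conjI algebraic_group_torus torus_dim comm_group_torus torus_connected torus_reductive
          algebraic_action_torus_act torus_act_not_linearizable)
qed

end
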